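(* Let $a>0$ be fixed, assume that the measure $U(dx)$ has a continuous density $u(x)$ with respect to Lebesgue measure on $(0,\infty)$, and let $0\le x<y<a$. Then, conditionally on $X_{\zeta-}=y$, the law of $X$ under $\mathbb P^\downarrow_x$ is that of $X$ under $\mathbb P^{\circ,y}_x$.
   Context: $\mathbb D$ is the space of càdlàg paths $\omega:[0,\infty)\to\mathbb R\cup\{\Delta\}$ with cemetery state $\Delta$: setting $\zeta=\inf\{t\ge0:\omega(t)=\Delta\}$ (the lifetime), $\omega(t)=\Delta$ for all $t\ge\zeta$. $X$ is the coordinate process and $(\mathcal F_t)_{t\ge0}$ its natural filtration; $X_{\zeta-}$ is the left limit of $X$ at its lifetime. Under $\mathbb P_x$, $x\in\mathbb R$, $X$ is a non-constant subordinator (Lévy process with non-decreasing paths) started from $x$, with $-\frac1t\log\mathbb E_0[e^{-\lambda X_t}]=\kappa\lambda+\int_0^\infty(1-e^{-\lambda z})\,\nu(dz)$ for $\lambda\ge0$, $t>0$, where $\kappa\ge0$ and $\int_{(0,\infty)}(1\wedge z)\,\nu(dz)<\infty$. The renewal function is $U(z)=\int_0^\infty\mathbb P_0(X_t\le z)\,dt$, with associated potential measure $U(dx)=\int_0^\infty\mathbb P_0(X_t\in dx)\,dt$. The measure $\mathbb P^\downarrow_x$ on $\mathbb D$ is the law of the killed process defined by $$\mathbb P^\downarrow_x(A;\,t<\zeta)=\mathbb E_x\Big[\frac{U(a-X_t)}{U(a-x)}\mathbf 1_{\{X_t<a\}\cap A}\Big],\qquad t\ge0,\ A\in\mathcal F_t,$$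 and for $y>0$, $x\in[0,y)$, the measure $\mathbb P^{\circ,y}_x$ on $\mathbb D$ is defined by $$\mathbb P^{\circ,y}_x(A;\,t<\zeta)=\mathbb E_x\Big[\frac{u(y-X_t)}{u(y-x)}\mathbf 1_{\{X_t<y\}\cap A}\Big],\qquad t\ge0,\ A\in\mathcal F_t.$$ *)

theory Defs
  imports "HOL-Probability.Probability"
begin

section \<open>Paths with a cemetery state\<close>

text \<open>The state space is \<open>real option\<close>: \<open>None\<close> is the cemetery state \<open>\<Delta>\<close>. A path is a function on
  \<open>[0, \<infinity>)\<close>, represented as a function on \<open>real\<close> that is \<open>undefined\<close> at negative times.\<close>

type_synonym path = "real \<Rightarrow> real option"

text \<open>The real line with \<open>\<Delta>\<close> adjoined as an isolated point.\<close>

definition cemetery_top :: "real option topology" where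
  "cemetery_top = topology (\<lambda>S. open (Some -` S))"

lemma openin_cemetery_top: "openin cemetery_top S \<longleftrightarrow> open (Some -` S)"
proof -
  have "istopology (\<lambda>S. open (Some -` S :: real set))"
    unfolding istopology_def by (auto simp: vimage_Union)
  then show ?thesis
    by (simp add: cemetery_top_def topology_inverse')
qed

definition cemetery_borel :: "real option measure" where
  "cemetery_borel = sigma UNIV {S. openin cemetery_top S}"

definition lifetime :: "path \<Rightarrow> ereal" where
  "lifetime \<omega> = (INF t\<in>{t. 0 \<le> t \<and> \<omega> t = None}. ereal t)"

definition paths :: "path set" where
  "paths = {\<omega> \<in> extensional {0..}.
     (\<forall>t\<ge>0. limitin cemetery_top \<omega> (\<omega> t) (at_right t)) \<and>
     (\<forall>t>0. \<exists>l. limitin cemetery_top \<omega> l (at_left t)) \<and>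
     (\<forall>t\<ge>0. lifetime \<omega> \<le> ereal t \<longrightarrow> \<omega> t = None)}"

definition coord_algebra :: "real set \<Rightarrow> path measure" where
  "coord_algebra I =
     sigma paths {{\<omega> \<in> paths. \<omega> t \<in> C} | t C. t \<in> I \<and> C \<in> sets cemetery_borel}"

definition path_space :: "path measure" where
  "path_space = coord_algebra {0..}"

definition filt :: "real \<Rightarrow> path measure" where
  "filt t = coord_algebra {0..t}"

text \<open>The real coordinate \<open>X\<^sub>t\<close>; it is only meaningful on \<open>{t < \<zeta>}\<close>.\<close>

definition X :: "real \<Rightarrow> path \<Rightarrow> real" where
  "X t \<omega> = the (\<omega> t)"

text \<open>The left limit at the lifetime, set to \<open>\<Delta>\<close> where it makes no sense, namely when
  the lifetime is \<open>0\<close> or \<open>\<infinity>\<close>.\<close>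

definition X_lifetime_left :: "path \<Rightarrow> real option" where
  "X_lifetime_left \<omega> =
     (if 0 < lifetime \<omega> \<and> lifetime \<omega> < \<infinity>
      then (THE l. limitin cemetery_top \<omega> l (at_left (real_of_ereal (lifetime \<omega>))))
      else None)"

section \<open>Subordinators\<close>

definition levy_process :: "path measure \<Rightarrow> bool" where
  "levy_process M \<longleftrightarrow>
     prob_space M \<and> sets M = sets path_space \<and>
     (AE \<omega> in M. lifetime \<omega> = \<infinity>) \<and>
     (AE \<omega> in M. X 0 \<omega> = 0) \<and>
     (\<forall>s\<ge>0. \<forall>t\<ge>0. distr M borel (\<lambda>\<omega>. X (s + t) \<omega> - X s \<omega>) = distr M borel (X t)) \<and>
     (\<forall>s\<ge>0. \<forall>t\<ge>0. prob_space.indep_set M (sets (filt s))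
        {(\<lambda>\<omega>. X (s + t) \<omega> - X s \<omega>) -` B \<inter> paths | B. B \<in> sets borel})"

text \<open>The measure \<open>\<nu>\<close> on \<open>(0, \<infinity>)\<close> is encoded as a Borel measure on the line
  without mass on \<open>(-\<infinity>, 0]\<close>.\<close>

definition jump_measure :: "real measure \<Rightarrow> bool" where
  "jump_measure \<nu> \<longleftrightarrow> sets \<nu> = sets borel \<and> emeasure \<nu> {..0} = 0 \<and>
     (\<integral>\<^sup>+z\<in>{0<..}. ennreal (min 1 z) \<partial>\<nu>) < \<infinity>"

definition shift_path :: "real \<Rightarrow> path \<Rightarrow> path" where
  "shift_path x \<omega> = (\<lambda>t\<in>{0..}. map_option (\<lambda>r. x + r) (\<omega> t))"

definition subordinator :: "real \<Rightarrow> real measure \<Rightarrow> (real \<Rightarrow> path measure) \<Rightarrow> bool" where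
  "subordinator \<kappa> \<nu> P \<longleftrightarrow>
     levy_process (P 0) \<and>
     (AE \<omega> in P 0. \<forall>s t. 0 \<le> s \<longrightarrow> s \<le> t \<longrightarrow> X s \<omega> \<le> X t \<omega>) \<and>
     \<not> (AE \<omega> in P 0. \<forall>t\<ge>0. X t \<omega> = X 0 \<omega>) \<and>
     0 \<le> \<kappa> \<and> jump_measure \<nu> \<and>
     (\<forall>q\<ge>0. \<forall>t>0. - (1 / t) * ln (\<integral>\<omega>. exp (- q * X t \<omega>) \<partial>P 0)
        = \<kappa> * q + (LINT z:{0<..}|\<nu>. 1 - exp (- q * z))) \<and>
     (\<forall>x. P x = distr (P 0) path_space (shift_path x))"

definition renewal :: "(real \<Rightarrow> path measure) \<Rightarrow> real \<Rightarrow> ennreal" where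
  "renewal P z = (\<integral>\<^sup>+t\<in>{0..}. emeasure (P 0) {\<omega> \<in> paths. X t \<omega> \<le> z} \<partial>lborel)"

definition potential :: "(real \<Rightarrow> path measure) \<Rightarrow> real measure" where
  "potential P = measure_of UNIV (sets borel)
     (\<lambda>B. \<integral>\<^sup>+t\<in>{0..}. emeasure (P 0) {\<omega> \<in> paths. X t \<omega> \<in> B} \<partial>lborel)"

text \<open>The whole potential measure, which lives on \<open>[0, \<infinity>)\<close>, is \<open>u(x) dx\<close> on \<open>(0, \<infinity>)\<close>. In
  particular it has no atom at \<open>0\<close>, which excludes compound Poisson processes.\<close>

definition continuous_potential_density ::
    "(real \<Rightarrow> path measure) \<Rightarrow> (real \<Rightarrow> real) \<Rightarrow> bool" where
  "continuous_potential_density P u \<longleftrightarrow>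
     continuous_on {0<..} u \<and> (\<forall>z>0. 0 \<le> u z) \<and>
     potential P = density lborel (\<lambda>z. ennreal (u z) * indicator {0<..} z)"

section \<open>The killed laws\<close>

text \<open>The sets \<open>A \<inter> {t < \<zeta>}\<close> with \<open>A \<in> \<F>\<^sub>t\<close> form, together with the whole space, an
  intersection-stable generator of the path space, so at most one probability measure satisfies
  each of the following two predicates.\<close>

definition down_law ::
    "(real \<Rightarrow> path measure) \<Rightarrow> real \<Rightarrow> real \<Rightarrow> path measure \<Rightarrow> bool" where
  "down_law P a x M \<longleftrightarrow> prob_space M \<and> sets M = sets path_space \<and>
     (\<forall>t\<ge>0. \<forall>A\<in>sets (filt t). emeasure M {\<omega> \<in> A. ereal t < lifetime \<omega>} =
        (\<integral>\<^sup>+\<omega>\<in>{\<omega> \<in> A. X t \<omega> < a}. renewal P (a - X t \<omega>) / renewal P (a - x) \<partial>P x))"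

definition circ_law ::
    "(real \<Rightarrow> path measure) \<Rightarrow> (real \<Rightarrow> real) \<Rightarrow> real \<Rightarrow> real \<Rightarrow> path measure \<Rightarrow> bool" where
  "circ_law P u y x M \<longleftrightarrow> prob_space M \<and> sets M = sets path_space \<and>
     (\<forall>t\<ge>0. \<forall>A\<in>sets (filt t). emeasure M {\<omega> \<in> A. ereal t < lifetime \<omega>} =
        (\<integral>\<^sup>+\<omega>\<in>{\<omega> \<in> A. X t \<omega> < y}. ennreal (u (y - X t \<omega>) / u (y - x)) \<partial>P x))"

section \<open>Conditional laws\<close>

text \<open>\<open>K z\<close>, \<open>z \<in> S\<close>, is a regular version of the conditional law under \<open>M\<close> given \<open>Z = z\<close>.\<close>

definition conditional_law_on ::
    "'w measure \<Rightarrow> ('w \<Rightarrow> 'z) \<Rightarrow> 'z measure \<Rightarrow> 'z set \<Rightarrow> ('z \<Rightarrow> 'w measure) \<Rightarrow> bool" where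
  "conditional_law_on M Z N S K \<longleftrightarrow>
     Z \<in> M \<rightarrow>\<^sub>M N \<and> S \<in> sets N \<and> K \<in> restrict_space N S \<rightarrow>\<^sub>M prob_algebra M \<and>
     (\<forall>A\<in>sets M. \<forall>B\<in>sets N. B \<subseteq> S \<longrightarrow>
        emeasure M (A \<inter> Z -` B) = (\<integral>\<^sup>+z\<in>B. emeasure (K z) A \<partial>distr M N Z))"

end

theory Submission
  imports Defs
begin

text \<open>The idea is that \<open>\<P>\<^sup>\<down>\<^sub>x\<close>, written \<open>Pdown\<close>, is the law of the subordinator killed at a random
time. Weight the pairs \<open>(\<omega>, s)\<close> of a path and a time \<open>s \<ge> 0\<close> by
\<open>\<one>{X\<^sub>s(\<omega>) < a} P\<^sub>x(d\<omega>) ds / U(a - x)\<close>. This is a probability, since the time spent below \<open>a\<close> has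
mean \<open>U(a - x)\<close>; and the Markov property at time \<open>t\<close> shows that the path killed at time \<open>s\<close> gives
mass \<open>E\<^sub>x[U(a - X\<^sub>t) \<one>{X\<^sub>t < a}; A] / U(a - x)\<close> to \<open>A \<inter> {t < \<zeta>}\<close> for every \<open>A \<in> \<F>\<^sub>t\<close>. Events of
this kind determine a law on the path space (\<open>path_law_eqI\<close>), so the killed path has law \<open>Pdown\<close>
(\<open>down_law_eq_killed\<close>).

The left limit at the lifetime of the path killed at \<open>s\<close> is \<open>X\<^sub>s\<^sub>-\<close>, which for all but countably many
\<open>s\<close> is \<open>X\<^sub>s\<close> because the path is monotone. Therefore, for \<open>A \<in> \<F>\<^sub>t\<close> and a Borel set \<open>C\<close> in \<open>(x, a)\<close>,

  \<open>U(a - x) Pdown(A, t < \<zeta>, X\<^sub>\<zeta>\<^sub>- \<in> C) = E\<^sub>x[\<one>\<^sub>A \<integral>\<^sub>t\<^sup>\<infinity> \<one>{X\<^sub>s \<in> C} ds] = \<integral>\<^sub>C E\<^sub>x[\<one>\<^sub>A u(y - X\<^sub>t) \<one>{X\<^sub>t < y}] dy\<close>,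

the second equality being again the Markov property at \<open>t\<close> (\<open>occupation_formula\<close>,
\<open>nn_integral_occupation_density\<close>). With \<open>t = 0\<close> this says that \<open>X\<^sub>\<zeta>\<^sub>-\<close> has density
\<open>u(y - x) / U(a - x)\<close> on \<open>(x, a)\<close> (\<open>nn_integral_left_limit_law\<close>), and dividing by this density turns
the integrand into the defining formula of \<open>Pcirc y\<close>. Dividing is harmless where \<open>u(y - x) = 0\<close>: the
potential measure is excessive, so the integrand vanishes there for almost every \<open>y\<close>
(\<open>occupation_density_null\<close>). A Dynkin argument extends the disintegration from the events
\<open>A \<inter> {t < \<zeta>}\<close> to all events (\<open>conditional_law_on_generatorI\<close>).

If \<open>U(a - x)\<close> is \<open>0\<close> or \<open>\<infinity>\<close>, the quotient in the definition of \<open>Pdown\<close> is \<open>0\<close> by the conventions of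
\<open>ennreal\<close>; then \<open>Pdown\<close> gives no mass to \<open>{0 < \<zeta>}\<close> and both sides of the disintegration are \<open>0\<close>.\<close>

section \<open>The state space\<close>

lemma sets_cemetery_borel: "C \<in> sets cemetery_borel \<longleftrightarrow> Some -` C \<in> sets borel"
proof
  assume "C \<in> sets cemetery_borel"
  then have "C \<in> sigma_sets UNIV {S. openin cemetery_top S}"
    by (simp add: cemetery_borel_def)
  then show "Some -` C \<in> sets borel"
  proof induction
    case (Compl S)
    have "space borel - Some -` S \<in> sets borel" using Compl.IH by (rule sets.compl_sets)
    also have "space borel - Some -` S = Some -` (UNIV - S)" by auto
    finally show ?case .
  qed (auto simp: openin_cemetery_top vimage_Union vimage_UN)
next
  assume "Some -` C \<in> sets borel"
  then have "Some -` C \<in> sigma_sets UNIV {S. open S}"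
    by (simp add: borel_def)
  moreover have "Some ` S \<in> sets cemetery_borel" if "S \<in> sigma_sets UNIV {S::real set. open S}" for S
    using that
  proof induction
    case (Basic S)
    have "Some -` Some ` S = S" by auto
    then have "openin cemetery_top (Some ` S)"
      using Basic by (simp add: openin_cemetery_top)
    then show ?case
      by (auto simp: cemetery_borel_def intro!: sigma_sets.Basic)
  next
    case (Compl S)
    have eq: "Some ` (UNIV - S) = Some ` UNIV - Some ` S" by auto
    have "Some -` range Some = (UNIV :: real set)" by auto
    then have "openin cemetery_top (range Some)" by (simp only: openin_cemetery_top open_UNIV)
    then have "range Some \<in> sets cemetery_borel"
      by (auto simp: cemetery_borel_def intro!: sigma_sets.Basic)
    with Compl show ?case unfolding eq by auto
  qed (auto simp: image_UN)
  ultimately have 1: "Some ` (Some -` C) \<in> sets cemetery_borel" by blast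
  have "openin cemetery_top {None}" by (simp add: openin_cemetery_top vimage_def)
  then have 2: "{None} \<in> sets cemetery_borel"
    by (auto simp: cemetery_borel_def intro!: sigma_sets.Basic)
  have eq: "C = Some ` (Some -` C) \<union> (if None \<in> C then {None} else {})"
  proof (intro set_eqI)
    fix z show "z \<in> C \<longleftrightarrow> z \<in> Some ` (Some -` C) \<union> (if None \<in> C then {None} else {})"
      by (cases z) auto
  qed
  have "(if None \<in> C then {None} else {}) \<in> sets cemetery_borel" using 2 by simp
  with 1 have "Some ` (Some -` C) \<union> (if None \<in> C then {None} else {}) \<in> sets cemetery_borel"
    by (rule sets.Un)
  then show "C \<in> sets cemetery_borel" by (simp only: eq[symmetric])
qed

lemma space_cemetery_borel [simp]: "space cemetery_borel = UNIV"
  by (simp add: cemetery_borel_def)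

lemma measurable_Some_cemetery_borel [measurable]: "Some \<in> borel \<rightarrow>\<^sub>M cemetery_borel"
  by (rule measurableI) (auto simp: sets_cemetery_borel)

lemma measurable_the_cemetery_borel [measurable]: "the \<in> cemetery_borel \<rightarrow>\<^sub>M borel"
  by (rule measurableI) (auto simp: sets_cemetery_borel vimage_def)

lemma topspace_cemetery_top: "topspace cemetery_top = UNIV"
proof -
  have "openin cemetery_top UNIV" by (simp add: openin_cemetery_top)
  then show ?thesis by (auto dest: openin_subset)
qed

lemma limitin_cemetery_None: "limitin cemetery_top f None F \<longleftrightarrow> eventually (\<lambda>t. f t = None) F"
proof
  assume "limitin cemetery_top f None F"
  moreover have "openin cemetery_top {None}" by (simp add: openin_cemetery_top vimage_def)
  ultimately show "eventually (\<lambda>t. f t = None) F" by (auto simp: limitin_def)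
next
  assume "eventually (\<lambda>t. f t = None) F"
  then show "limitin cemetery_top f None F"
    by (auto simp: limitin_def topspace_cemetery_top elim: eventually_mono)
qed

lemma limitin_cemetery_Some:
  "limitin cemetery_top f (Some r) F \<longleftrightarrow>
     eventually (\<lambda>t. f t \<noteq> None) F \<and> ((\<lambda>t. the (f t)) \<longlongrightarrow> r) F" (is "?L \<longleftrightarrow> ?R")
proof
  assume L: ?L
  have *: "eventually (\<lambda>t. f t \<in> Some ` S) F" if "open S" "r \<in> S" for S
  proof -
    have "Some -` Some ` S = S" by auto
    then have "openin cemetery_top (Some ` S)" using that by (simp add: openin_cemetery_top)
    then show ?thesis using L that by (auto simp: limitin_def)
  qed
  show ?R
  proof (intro conjI topological_tendstoI)
    show "eventually (\<lambda>t. f t \<noteq> None) F" using *[of UNIV] by (auto elim: eventually_mono)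
    show "eventually (\<lambda>t. the (f t) \<in> S) F" if "open S" "r \<in> S" for S
      using *[OF that] by (auto elim: eventually_mono)
  qed
next
  assume R: ?R
  have "eventually (\<lambda>t. f t \<in> S) F" if "openin cemetery_top S" "Some r \<in> S" for S
  proof -
    have "eventually (\<lambda>t. the (f t) \<in> Some -` S) F"
      using R that by (intro topological_tendstoD[where l = r]) (auto simp: openin_cemetery_top)
    moreover have "eventually (\<lambda>t. f t \<noteq> None) F" using R by simp
    ultimately show ?thesis by eventually_elim auto
  qed
  then show ?L by (auto simp: limitin_def topspace_cemetery_top)
qed

section \<open>Coordinates, lifetime and filtration on the path space\<close>

lemma space_coord_algebra [simp]: "space (coord_algebra I) = paths"
  by (simp add: coord_algebra_def space_measure_of_conv)

lemma space_path_space [simp]: "space path_space = paths"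
  by (simp add: path_space_def)

lemma space_filt [simp]: "space (filt t) = paths"
  by (simp add: filt_def)

lemma paths_in_sets [simp]:
  "paths \<in> sets (coord_algebra I)" "paths \<in> sets path_space" "paths \<in> sets (filt t)"
  using sets.top[of "coord_algebra I"] sets.top[of path_space] sets.top[of "filt t"]
  unfolding space_coord_algebra space_path_space space_filt .

lemma sets_coord_algebra:
  "sets (coord_algebra I) = sigma_sets paths {{\<omega> \<in> paths. \<omega> t \<in> C} | t C. t \<in> I \<and> C \<in> sets cemetery_borel}"
  unfolding coord_algebra_def by (rule sets_measure_of) auto

lemma measurable_coord:
  "t \<in> I \<Longrightarrow> (\<lambda>\<omega>. \<omega> t) \<in> coord_algebra I \<rightarrow>\<^sub>M cemetery_borel"
  by (rule measurableI)
    (auto simp: sets_coord_algebra vimage_def Int_def conj_commute intro!: sigma_sets.Basic)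

lemma measurable_into_coord_algebra:
  assumes "f \<in> space M \<rightarrow> paths" and "\<And>t. t \<in> I \<Longrightarrow> (\<lambda>x. f x t) \<in> M \<rightarrow>\<^sub>M cemetery_borel"
  shows "f \<in> M \<rightarrow>\<^sub>M coord_algebra I"
  unfolding coord_algebra_def
proof (rule measurable_measure_of)
  fix E assume "E \<in> {{\<omega> \<in> paths. \<omega> t \<in> C} | t C. t \<in> I \<and> C \<in> sets cemetery_borel}"
  then obtain t C where "t \<in> I" "C \<in> sets cemetery_borel" and E: "E = {\<omega> \<in> paths. \<omega> t \<in> C}" by auto
  then have "(\<lambda>x. f x t) -` C \<inter> space M \<in> sets M" using assms(2) by (auto intro: measurable_sets)
  also have "(\<lambda>x. f x t) -` C \<inter> space M = f -` E \<inter> space M" using assms(1) E by auto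
  finally show "f -` E \<inter> space M \<in> sets M" .
qed (use assms in auto)

lemma sets_filt_subset:
  assumes "s \<le> t"
  shows "sets (filt s) \<subseteq> sets (filt t)"
proof -
  have "{0..s} \<subseteq> {0..t}" using assms by auto
  then show ?thesis
    unfolding filt_def sets_coord_algebra by (intro sigma_sets_mono') blast
qed

lemma sets_filt_path_space: "sets (filt t) \<subseteq> sets path_space"
  unfolding filt_def path_space_def sets_coord_algebra by (rule sigma_sets_mono') auto

lemma measurable_id_filt: "(\<lambda>\<omega>. \<omega>) \<in> path_space \<rightarrow>\<^sub>M filt t"
proof (rule measurableI)
  fix A assume "A \<in> sets (filt t)"
  then have "A \<in> sets path_space" using sets_filt_path_space by blast
  then show "(\<lambda>\<omega>. \<omega>) -` A \<inter> space path_space \<in> sets path_space"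
    using sets.sets_into_space[of A path_space] by (simp add: Int_absorb2)
qed simp

lemma measurable_X_filt: "0 \<le> s \<Longrightarrow> s \<le> t \<Longrightarrow> X s \<in> borel_measurable (filt t)"
  unfolding X_def [abs_def] filt_def
  by (rule measurable_compose[OF measurable_coord]) auto

lemma measurable_X: "0 \<le> t \<Longrightarrow> X t \<in> borel_measurable path_space"
  unfolding X_def [abs_def] path_space_def
  by (rule measurable_compose[OF measurable_coord]) auto

lemma lifetime_le: "0 \<le> t \<Longrightarrow> \<omega> t = None \<Longrightarrow> lifetime \<omega> \<le> ereal t"
  unfolding lifetime_def by (rule INF_lower2[of t]) auto

lemma lifetime_nonneg: "0 \<le> lifetime \<omega>"
  unfolding lifetime_def by (rule INF_greatest) auto

text \<open>The infimum in the lifetime is attained, which is part of the definition of \<open>paths\<close>.\<close>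

lemma less_lifetime_iff: "\<omega> \<in> paths \<Longrightarrow> 0 \<le> t \<Longrightarrow> ereal t < lifetime \<omega> \<longleftrightarrow> \<omega> t \<noteq> None"
  using lifetime_le[of t \<omega>] unfolding paths_def by (auto simp: not_less[symmetric])

lemma measurable_lifetime [measurable]: "lifetime \<in> borel_measurable path_space"
  unfolding borel_measurable_iff_Iic_ereal
proof
  fix a :: ereal
  show "lifetime -` {..a} \<inter> space path_space \<in> sets path_space"
  proof (cases "0 \<le> a \<and> a < \<infinity>")
    case False
    then consider "a < 0" | "a = \<infinity>" by (cases a) auto
    then show ?thesis
    proof cases
      case 1
      have "\<not> lifetime \<omega> \<le> a" for \<omega>
      proof
        assume "lifetime \<omega> \<le> a"
        with lifetime_nonneg have "0 \<le> a" by (rule order_trans)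
        with 1 show False by simp
      qed
      then have "lifetime -` {..a} = {}" by auto
      then show ?thesis by simp
    next
      case 2
      then have "lifetime -` {..a} \<inter> space path_space = space path_space" by auto
      then show ?thesis by (simp only: sets.top)
    qed
  next
    case True
    then obtain t where a: "a = ereal t" "0 \<le> t" by (cases a) auto
    have "lifetime -` {..a} \<inter> space path_space = (\<lambda>\<omega>. \<omega> t) -` {None} \<inter> space path_space"
      using a less_lifetime_iff[of _ t] by (auto simp: not_less[symmetric])
    also have "\<dots> \<in> sets path_space"
      unfolding path_space_def using a
      by (intro measurable_sets[OF measurable_coord]) (auto simp: sets_cemetery_borel vimage_def)
    finally show ?thesis .
  qed
qed

lemma sets_filt_lifetime:
  assumes "0 \<le> t" "A \<in> sets (filt t)"
  shows "{\<omega> \<in> A. ereal t < lifetime \<omega>} \<in> sets (filt t)"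
proof -
  have "{\<omega> \<in> A. ereal t < lifetime \<omega>} = A \<inter> ((\<lambda>\<omega>. \<omega> t) -` (- {None}) \<inter> space (filt t))"
    using sets.sets_into_space[OF assms(2)] less_lifetime_iff[of _ t] assms(1) by auto
  moreover have "(\<lambda>\<omega>. \<omega> t) -` (- {None}) \<inter> space (filt t) \<in> sets (filt t)"
    using assms(1) unfolding filt_def
    by (intro measurable_sets[OF measurable_coord]) (auto simp: sets_cemetery_borel vimage_def)
  ultimately show ?thesis using assms(2) by auto
qed

lemma X_right_continuous:
  assumes "\<omega> \<in> paths" "0 \<le> t"
  shows "((\<lambda>s. X s \<omega>) \<longlongrightarrow> X t \<omega>) (at_right t)"
proof -
  have lim: "limitin cemetery_top \<omega> (\<omega> t) (at_right t)" using assms by (auto simp: paths_def)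
  show ?thesis
  proof (cases "\<omega> t")
    case None
    then have "eventually (\<lambda>s. X s \<omega> = X t \<omega>) (at_right t)"
      using lim by (auto simp: limitin_cemetery_None X_def elim: eventually_mono)
    then show ?thesis by (simp add: tendsto_eventually)
  next
    case (Some r)
    then show ?thesis using lim by (simp add: limitin_cemetery_Some X_def)
  qed
qed

text \<open>Right continuity makes the process the limit of its values at the grid points
\<open>(k + 1) / (n + 1)\<close> just above \<open>t\<close>. Measurability at negative times comes for free by freezing the
process there at its value at time \<open>0\<close>.\<close>

lemma measurable_X_pair:
  "(\<lambda>(\<omega>, t). X (max 0 t) \<omega>) \<in> borel_measurable (path_space \<Otimes>\<^sub>M borel)"
proof (rule borel_measurable_LIMSEQ_real)
  define k where "k n t = nat \<lfloor>max 0 t * (real n + 1)\<rfloor>" for n :: nat and t :: real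
  define g where "g n t = (real (k n t) + 1) / (real n + 1)" for n and t :: real
  show "(\<lambda>n. case z of (\<omega>, t) \<Rightarrow> X (g n t) \<omega>) \<longlonglongrightarrow> (case z of (\<omega>, t) \<Rightarrow> X (max 0 t) \<omega>)"
    if "z \<in> space (path_space \<Otimes>\<^sub>M borel)" for z
  proof -
    obtain \<omega> t where z: "z = (\<omega>, t)" by (cases z)
    with that have \<omega>: "\<omega> \<in> paths" by (simp add: space_pair_measure)
    have b: "max 0 t < g n t" "g n t \<le> max 0 t + 1 / (real n + 1)" for n
    proof -
      define y where "y = max 0 t * (real n + 1)"
      have y: "0 \<le> y" by (simp add: y_def)
      have r: "real (k n t) \<le> y" "y < real (k n t) + 1"
        using y unfolding k_def y_def[symmetric] by linarith+
      have "y / (real n + 1) < (real (k n t) + 1) / (real n + 1)"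
        using r by (intro divide_strict_right_mono) auto
      then show "max 0 t < g n t" by (simp add: y_def g_def)
      have "real (k n t) / (real n + 1) \<le> y / (real n + 1)"
        using r by (intro divide_right_mono) auto
      then show "g n t \<le> max 0 t + 1 / (real n + 1)" by (simp add: y_def g_def add_divide_distrib)
    qed
    have "(\<lambda>n. max 0 t + 1 / (real n + 1)) \<longlonglongrightarrow> max 0 t + 0"
      by (intro tendsto_add tendsto_const)
        (use LIMSEQ_inverse_real_of_nat in \<open>simp add: inverse_eq_divide add.commute\<close>)
    then have lim: "(\<lambda>n. max 0 t + 1 / (real n + 1)) \<longlonglongrightarrow> max 0 t"
      unfolding add_0_right .
    have "(\<lambda>n. g n t) \<longlonglongrightarrow> max 0 t"
    proof (rule real_tendsto_sandwich[OF always_eventually always_eventually tendsto_const lim])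
      show "\<forall>n. max 0 t \<le> g n t" using less_imp_le[OF b(1)] by (rule allI)
      show "\<forall>n. g n t \<le> max 0 t + 1 / (real n + 1)" using b(2) by (rule allI)
    qed
    then have "filterlim (\<lambda>n. g n t) (at_right (max 0 t)) sequentially"
      unfolding filterlim_at
    proof (intro conjI always_eventually allI)
      show "g n t \<in> {max 0 t<..}" for n using b(1) by (simp only: greaterThan_iff)
      show "g n t \<noteq> max 0 t" for n using less_imp_neq[OF b(1)[of n]] by (rule not_sym)
    qed
    from filterlim_compose[OF X_right_continuous[OF \<omega> max.cobounded1] this] show ?thesis
      by (simp only: z prod.case)
  qed
  show "(\<lambda>z. case z of (\<omega>, t) \<Rightarrow> X (g n t) \<omega>) \<in> borel_measurable (path_space \<Otimes>\<^sub>M borel)" for n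
  proof -
    have "(\<lambda>z. X ((real (k n (snd z)) + 1) / (real n + 1)) (fst z)) \<in> borel_measurable (path_space \<Otimes>\<^sub>M borel)"
    proof (rule measurable_compose_countable[of "\<lambda>i z. X ((real i + 1) / (real n + 1)) (fst z)"])
      show "(\<lambda>z. X ((real i + 1) / (real n + 1)) (fst z)) \<in> borel_measurable (path_space \<Otimes>\<^sub>M borel)" for i
        by (rule measurable_compose[OF measurable_fst measurable_X]) simp
      show "(\<lambda>z. k n (snd z)) \<in> path_space \<Otimes>\<^sub>M borel \<rightarrow>\<^sub>M count_space UNIV"
        unfolding k_def by measurable
    qed
    then show ?thesis unfolding g_def case_prod_beta .
  qed
qed

section \<open>Translated and killed paths\<close>

lemma paths_left_limit:
  assumes "\<omega> \<in> paths" "0 < t"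
  obtains l where "limitin cemetery_top \<omega> l (at_left t)"
proof -
  have "\<forall>t>0. \<exists>l. limitin cemetery_top \<omega> l (at_left t)" using assms(1) unfolding paths_def by blast
  with assms(2) that show thesis by blast
qed

lemma lifetime_shift_path: "lifetime (shift_path x \<omega>) = lifetime \<omega>"
  unfolding lifetime_def by (rule arg_cong[where f = Inf]) (auto simp: shift_path_def)

lemma shift_path_in_paths:
  assumes "\<omega> \<in> paths"
  shows "shift_path x \<omega> \<in> paths"
proof -
  have lim: "limitin cemetery_top (shift_path x \<omega>) (map_option ((+) x) l) F"
    if "limitin cemetery_top \<omega> l F" "eventually (\<lambda>t. 0 \<le> t) F" for l F
  proof -
    have "limitin cemetery_top (\<lambda>t. map_option ((+) x) (\<omega> t)) (map_option ((+) x) l) F"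
    proof (cases l)
      case None
      then show ?thesis using that by (simp add: limitin_cemetery_None)
    next
      case (Some r)
      then have ev: "eventually (\<lambda>t. \<omega> t \<noteq> None) F" and "((\<lambda>t. the (\<omega> t)) \<longlongrightarrow> r) F"
        using that by (simp_all add: limitin_cemetery_Some)
      then have "((\<lambda>t. x + the (\<omega> t)) \<longlongrightarrow> x + r) F" by (intro tendsto_intros)
      moreover have "eventually (\<lambda>t. x + the (\<omega> t) = the (map_option ((+) x) (\<omega> t))) F"
        using ev by eventually_elim auto
      ultimately have "((\<lambda>t. the (map_option ((+) x) (\<omega> t))) \<longlongrightarrow> x + r) F"
        by (rule Lim_transform_eventually)
      then show ?thesis using Some ev by (simp add: limitin_cemetery_Some)
    qed
    moreover have "eventually (\<lambda>t. map_option ((+) x) (\<omega> t) = shift_path x \<omega> t) F"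
      using that(2) by eventually_elim (simp add: shift_path_def)
    ultimately show ?thesis by (rule limitin_transform_eventually[rotated])
  qed
  have None_iff: "shift_path x \<omega> t = None \<longleftrightarrow> \<omega> t = None" if "0 \<le> t" for t
    using that by (simp add: shift_path_def)
  have right: "eventually (\<lambda>s. 0 \<le> s) (at_right t)" if "0 \<le> t" for t :: real
    using eventually_at_right_less[of t] that by (auto elim: eventually_mono)
  have left: "eventually (\<lambda>s. 0 \<le> s) (at_left t)" if "0 < t" for t :: real
    using eventually_at_left_real[OF that] by (auto elim: eventually_mono)
  note lifetime_shift_path[of x \<omega>]
  moreover have "limitin cemetery_top (shift_path x \<omega>) (shift_path x \<omega> t) (at_right t)" if "0 \<le> t" for t
    using lim[of "\<omega> t" "at_right t"] assms that right by (auto simp: paths_def shift_path_def)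
  moreover have "\<exists>l. limitin cemetery_top (shift_path x \<omega>) l (at_left t)" if t: "0 < t" for t
  proof -
    obtain l where l: "limitin cemetery_top \<omega> l (at_left t)" using assms t by (rule paths_left_limit)
    from lim[OF l left[OF t]] show ?thesis by blast
  qed
  moreover have "shift_path x \<omega> \<in> extensional {0..}" by (simp add: shift_path_def)
  moreover have "\<forall>t\<ge>0. lifetime \<omega> \<le> ereal t \<longrightarrow> \<omega> t = None" using assms by (simp add: paths_def)
  ultimately show ?thesis unfolding paths_def by (simp add: None_iff)
qed

lemma X_shift_path: "0 \<le> t \<Longrightarrow> \<omega> t \<noteq> None \<Longrightarrow> X t (shift_path x \<omega>) = x + X t \<omega>"
  by (auto simp: X_def shift_path_def)

lemma measurable_shift_path:
  assumes "I \<subseteq> {0..}"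
  shows "shift_path x \<in> coord_algebra I \<rightarrow>\<^sub>M coord_algebra I"
proof (rule measurable_into_coord_algebra)
  fix t assume t: "t \<in> I"
  have "map_option ((+) x) \<in> cemetery_borel \<rightarrow>\<^sub>M cemetery_borel"
  proof (rule measurableI)
    fix C assume "C \<in> sets cemetery_borel"
    then have "(+) x -` (Some -` C) \<inter> space borel \<in> sets borel"
      by (intro measurable_sets[of _ borel borel]) (simp_all add: sets_cemetery_borel)
    then show "map_option ((+) x) -` C \<inter> space cemetery_borel \<in> sets cemetery_borel"
      by (simp add: sets_cemetery_borel vimage_def)
  qed simp
  then have "(\<lambda>\<omega>. map_option ((+) x) (\<omega> t)) \<in> coord_algebra I \<rightarrow>\<^sub>M cemetery_borel"
    using measurable_coord[OF t] by (rule measurable_compose[rotated])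
  then show "(\<lambda>\<omega>. shift_path x \<omega> t) \<in> coord_algebra I \<rightarrow>\<^sub>M cemetery_borel"
    using t assms by (auto simp: shift_path_def)
qed (auto simp: shift_path_in_paths)

text \<open>Paths are \<open>undefined\<close> at negative times; for \<open>s \<le> 0\<close> the killed path is \<open>\<Delta>\<close> from the start.\<close>

definition kill_path :: "real \<Rightarrow> path \<Rightarrow> path" where
  "kill_path s \<omega> = (\<lambda>t\<in>{0..}. if t < s then \<omega> t else None)"

lemma kill_path_in_paths:
  assumes "\<omega> \<in> paths"
  shows "kill_path s \<omega> \<in> paths"
proof -
  have right: "limitin cemetery_top (kill_path s \<omega>) (kill_path s \<omega> t) (at_right t)" if t: "0 \<le> t" for t
  proof (cases "t < s")
    case True
    have "eventually (\<lambda>r. \<omega> r = kill_path s \<omega> r) (at_right t)"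
      using eventually_at_right_real[OF True] t
      by (auto simp: kill_path_def elim: eventually_mono)
    moreover have "limitin cemetery_top \<omega> (\<omega> t) (at_right t)" using assms t by (simp add: paths_def)
    ultimately have "limitin cemetery_top (kill_path s \<omega>) (\<omega> t) (at_right t)"
      by (rule limitin_transform_eventually)
    then show ?thesis using t True by (simp add: kill_path_def)
  next
    case False
    then have "eventually (\<lambda>r. kill_path s \<omega> r = None) (at_right t)"
      using eventually_at_right_less[of t] t by (auto simp: kill_path_def elim: eventually_mono)
    then show ?thesis using t False by (simp add: kill_path_def limitin_cemetery_None)
  qed
  have left: "\<exists>l. limitin cemetery_top (kill_path s \<omega>) l (at_left t)" if t: "0 < t" for t
  proof (cases "t \<le> s")
    case True
    have "eventually (\<lambda>r. \<omega> r = kill_path s \<omega> r) (at_left t)"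
      using eventually_at_left_real[OF t] True
      by (auto simp: kill_path_def elim: eventually_mono)
    moreover obtain l where "limitin cemetery_top \<omega> l (at_left t)" using assms t by (rule paths_left_limit)
    ultimately show ?thesis by (blast intro: limitin_transform_eventually)
  next
    case False
    then have "max 0 s < t" using t by simp
    then have "eventually (\<lambda>r. r \<in> {max 0 s<..<t}) (at_left t)" by (rule eventually_at_left_real)
    then have "eventually (\<lambda>r. kill_path s \<omega> r = None) (at_left t)"
      by (auto simp: kill_path_def elim: eventually_mono)
    then show ?thesis by (auto simp: limitin_cemetery_None[symmetric])
  qed
  have "kill_path s \<omega> t = None" if t: "0 \<le> t" "lifetime (kill_path s \<omega>) \<le> ereal t" for t
  proof (rule ccontr)
    assume "kill_path s \<omega> t \<noteq> None"
    then have "t < s" "\<omega> t \<noteq> None" using t by (auto simp: kill_path_def split: if_splits)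
    then have "ereal t < min (ereal s) (lifetime \<omega>)"
      using less_lifetime_iff[OF assms t(1)] by simp
    also have "\<dots> \<le> lifetime (kill_path s \<omega>)"
      unfolding lifetime_def[of "kill_path s \<omega>"]
    proof (rule INF_greatest)
      fix r assume r: "r \<in> {t. 0 \<le> t \<and> kill_path s \<omega> t = None}"
      then have "s \<le> r \<or> \<omega> r = None" by (auto simp: kill_path_def split: if_splits)
      then show "min (ereal s) (lifetime \<omega>) \<le> ereal r"
        using r lifetime_le[of r \<omega>] by (auto simp: min_le_iff_disj)
    qed
    finally show False using t by simp
  qed
  moreover have "kill_path s \<omega> \<in> extensional {0..}" by (simp add: kill_path_def)
  ultimately show ?thesis using left right unfolding paths_def by simp
qed

lemma less_lifetime_kill_path:
  assumes "\<omega> \<in> paths" "0 \<le> t"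
  shows "ereal t < lifetime (kill_path s \<omega>) \<longleftrightarrow> t < s \<and> ereal t < lifetime \<omega>"
proof -
  have "ereal t < lifetime (kill_path s \<omega>) \<longleftrightarrow> kill_path s \<omega> t \<noteq> None"
    using assms by (intro less_lifetime_iff kill_path_in_paths)
  also have "\<dots> \<longleftrightarrow> t < s \<and> \<omega> t \<noteq> None" using assms by (simp add: kill_path_def)
  finally show ?thesis using less_lifetime_iff[OF assms] by simp
qed

lemma lifetime_kill_path:
  assumes "\<omega> \<in> paths" "lifetime \<omega> = \<infinity>" "0 \<le> s"
  shows "lifetime (kill_path s \<omega>) = ereal s"
proof (rule antisym)
  show "lifetime (kill_path s \<omega>) \<le> ereal s"
    using assms by (intro lifetime_le) (auto simp: kill_path_def)
  show "ereal s \<le> lifetime (kill_path s \<omega>)"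
    unfolding lifetime_def
  proof (rule INF_greatest)
    fix r assume r: "r \<in> {t. 0 \<le> t \<and> kill_path s \<omega> t = None}"
    then have "s \<le> r \<or> \<omega> r = None" by (auto simp: kill_path_def split: if_splits)
    then show "ereal s \<le> ereal r"
      using assms r less_lifetime_iff[of \<omega> r] by auto
  qed
qed

text \<open>The sets with this property form a sigma-algebra that contains the coordinate events up to
time \<open>t\<close>. It is used to pass from a path to the path killed after \<open>t\<close>.\<close>

lemma filt_determined:
  assumes "A \<in> sets (filt t)" "\<omega> \<in> paths" "\<omega>' \<in> paths"
    and "\<And>s. 0 \<le> s \<Longrightarrow> s \<le> t \<Longrightarrow> \<omega> s = \<omega>' s"
  shows "\<omega> \<in> A \<longleftrightarrow> \<omega>' \<in> A"
  using assms(1) unfolding filt_def sets_coord_algebra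
  by induction (use assms(2-) in auto)

lemma measurable_kill_path:
  "(\<lambda>(\<omega>, s). kill_path s \<omega>) \<in> path_space \<Otimes>\<^sub>M borel \<rightarrow>\<^sub>M path_space"
  unfolding path_space_def
proof (rule measurable_into_coord_algebra)
  show "(\<lambda>(\<omega>, s). kill_path s \<omega>) \<in> space (coord_algebra {0..} \<Otimes>\<^sub>M borel) \<rightarrow> paths"
    by (auto simp: space_pair_measure kill_path_in_paths)
  fix t :: real assume t: "t \<in> {0..}"
  have [measurable]: "(\<lambda>\<omega>. \<omega> t) \<in> coord_algebra {0..} \<rightarrow>\<^sub>M cemetery_borel"
    using t by (rule measurable_coord)
  have "(\<lambda>z. if t < snd z then fst z t else None) \<in> coord_algebra {0..} \<Otimes>\<^sub>M borel \<rightarrow>\<^sub>M cemetery_borel"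
    by (intro measurable_If measurable_compose[OF measurable_fst]) measurable
  then show "(\<lambda>z. (case z of (\<omega>, s) \<Rightarrow> kill_path s \<omega>) t) \<in> coord_algebra {0..} \<Otimes>\<^sub>M borel \<rightarrow>\<^sub>M cemetery_borel"
    using t by (simp add: kill_path_def case_prod_beta)
qed

section \<open>The left limit at the lifetime\<close>

lemma X_lifetime_left_eqI:
  assumes "\<omega> \<in> paths" "lifetime \<omega> = ereal r" "0 < r" "((\<lambda>s. X s \<omega>) \<longlongrightarrow> l) (at_left r)"
  shows "X_lifetime_left \<omega> = Some l"
proof -
  have "eventually (\<lambda>s. s \<in> {0<..<r}) (at_left r)" using eventually_at_left_real[OF assms(3)] .
  then have ev: "eventually (\<lambda>s. \<omega> s \<noteq> None) (at_left r)"
  proof eventually_elim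
    case (elim s)
    then show ?case using less_lifetime_iff[OF assms(1), of s] by (simp add: assms(2))
  qed
  have "limitin cemetery_top \<omega> l' (at_left r) \<longleftrightarrow> l' = Some l" for l'
  proof (cases l')
    case None
    have "\<not> eventually (\<lambda>s. \<omega> s = None) (at_left r)"
    proof
      assume "eventually (\<lambda>s. \<omega> s = None) (at_left r)"
      with ev have "eventually (\<lambda>s. False) (at_left r)" by eventually_elim simp
      then show False by simp
    qed
    then show ?thesis using None by (simp add: limitin_cemetery_None)
  next
    case (Some r')
    then show ?thesis using ev assms(4) tendsto_unique[of "at_left r" "\<lambda>s. X s \<omega>"]
      by (auto simp: limitin_cemetery_Some X_def)
  qed
  then show ?thesis using assms by (simp add: X_lifetime_left_def)
qed

lemma ex_left_limit_at_lifetime: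
  assumes "\<omega> \<in> paths" "lifetime \<omega> = ereal r" "0 < r"
  shows "\<exists>l. ((\<lambda>s. X s \<omega>) \<longlongrightarrow> l) (at_left r)"
proof -
  obtain l where l: "limitin cemetery_top \<omega> l (at_left r)" using assms(1,3) by (rule paths_left_limit)
  then show ?thesis
  proof (cases l)
    case None
    with l have "eventually (\<lambda>s. X s \<omega> = the None) (at_left r)"
      by (auto simp: limitin_cemetery_None X_def elim: eventually_mono)
    then show ?thesis by (auto intro: tendsto_eventually)
  qed (use l in \<open>auto simp: limitin_cemetery_Some X_def\<close>)
qed

lemma X_lifetime_left_None:
  assumes "\<not> (0 < lifetime \<omega> \<and> lifetime \<omega> < \<infinity>)"
  shows "X_lifetime_left \<omega> = None"
  using assms by (simp only: X_lifetime_left_def if_False)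

text \<open>Where the lifetime is positive and finite, the left limit is the limit of the values of the
process at the last points strictly before \<open>\<zeta>\<close> of the grids of mesh \<open>1 / (n + 1)\<close>.\<close>

lemma measurable_X_lifetime_left: "X_lifetime_left \<in> path_space \<rightarrow>\<^sub>M cemetery_borel"
proof -
  define D where "D = {\<omega> \<in> space path_space. 0 < lifetime \<omega> \<and> lifetime \<omega> < \<infinity>}"
  define k where "k n \<omega> = nat (\<lceil>real_of_ereal (lifetime \<omega>) * (real n + 1)\<rceil> - 1)" for n :: nat and \<omega>
  define g where "g n \<omega> = real (k n \<omega>) / (real n + 1)" for n :: nat and \<omega>
  have D [measurable]: "D \<in> sets path_space" unfolding D_def by measurable
  have "(\<lambda>\<omega>. if \<omega> \<in> D then the (X_lifetime_left \<omega>) else 0) \<in> borel_measurable path_space"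
  proof (rule borel_measurable_LIMSEQ_real)
    show "(\<lambda>n. if \<omega> \<in> D then X (g n \<omega>) \<omega> else 0) \<longlonglongrightarrow> (if \<omega> \<in> D then the (X_lifetime_left \<omega>) else 0)"
      if "\<omega> \<in> space path_space" for \<omega>
    proof (cases "\<omega> \<in> D")
      case True
      then obtain r where r: "lifetime \<omega> = ereal r" "0 < r" "\<omega> \<in> paths"
        by (cases "lifetime \<omega>") (auto simp: D_def)
      obtain l where l: "((\<lambda>s. X s \<omega>) \<longlongrightarrow> l) (at_left r)"
        using ex_left_limit_at_lifetime[OF r(3,1,2)] by blast
      have b: "g n \<omega> < r" "r - 1 / (real n + 1) \<le> g n \<omega>" for n
      proof -
        define y where "y = r * (real n + 1)"
        have "0 < y" using r by (simp add: y_def)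
        then have k: "real (k n \<omega>) < y" "y \<le> real (k n \<omega>) + 1"
        proof -
          have "real (k n \<omega>) = of_int \<lceil>y\<rceil> - 1"
            using \<open>0 < y\<close> by (simp add: k_def r(1) y_def)
          then show "real (k n \<omega>) < y" "y \<le> real (k n \<omega>) + 1" by linarith+
        qed
        have "real (k n \<omega>) / (real n + 1) < y / (real n + 1)"
          using k by (intro divide_strict_right_mono) auto
        then show "g n \<omega> < r" by (simp add: y_def g_def)
        have "y / (real n + 1) \<le> (real (k n \<omega>) + 1) / (real n + 1)"
          using k by (intro divide_right_mono) auto
        then show "r - 1 / (real n + 1) \<le> g n \<omega>" by (simp add: y_def g_def add_divide_distrib)
      qed
      have "(\<lambda>n. r - 1 / (real n + 1)) \<longlonglongrightarrow> r - 0"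
        by (intro tendsto_diff tendsto_const)
          (use LIMSEQ_inverse_real_of_nat in \<open>simp add: inverse_eq_divide add.commute\<close>)
      then have lim: "(\<lambda>n. r - 1 / (real n + 1)) \<longlonglongrightarrow> r" unfolding diff_0_right .
      have "(\<lambda>n. g n \<omega>) \<longlonglongrightarrow> r"
      proof (rule real_tendsto_sandwich[OF always_eventually always_eventually lim tendsto_const])
        show "\<forall>n. r - 1 / (real n + 1) \<le> g n \<omega>" using b(2) by (rule allI)
        show "\<forall>n. g n \<omega> \<le> r" using less_imp_le[OF b(1)] by (rule allI)
      qed
      then have "filterlim (\<lambda>n. g n \<omega>) (at_left r) sequentially"
        unfolding filterlim_at
      proof (intro conjI always_eventually allI)
        show "g n \<omega> \<in> {..<r}" for n using b(1) by (simp only: lessThan_iff)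
        show "g n \<omega> \<noteq> r" for n using b(1) by (rule less_imp_neq)
      qed
      from filterlim_compose[OF l this] show ?thesis
        using True X_lifetime_left_eqI[OF r(3,1,2) l] by simp
    qed simp
    show "(\<lambda>\<omega>. if \<omega> \<in> D then X (g n \<omega>) \<omega> else 0) \<in> borel_measurable path_space" for n
    proof -
      have "(\<lambda>\<omega>. X (real (k n \<omega>) / (real n + 1)) \<omega>) \<in> borel_measurable path_space"
      proof (rule measurable_compose_countable[of "\<lambda>i. X (real i / (real n + 1))"])
        show "X (real i / (real n + 1)) \<in> borel_measurable path_space" for i
          by (rule measurable_X) simp
        show "k n \<in> path_space \<rightarrow>\<^sub>M count_space UNIV"
          unfolding k_def [abs_def] by measurable
      qed
      then show ?thesis unfolding g_def using D by (intro measurable_If_set sets.Int) auto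
    qed
  qed
  from measurable_compose[OF this measurable_Some_cemetery_borel]
  have "(\<lambda>\<omega>. if \<omega> \<in> D then Some (if \<omega> \<in> D then the (X_lifetime_left \<omega>) else 0) else None)
      \<in> path_space \<rightarrow>\<^sub>M cemetery_borel"
  proof (rule measurable_If_set)
    show "D \<inter> space path_space \<in> sets path_space" using D by (intro sets.Int) simp_all
  qed simp
  moreover have "(if \<omega> \<in> D then Some (if \<omega> \<in> D then the (X_lifetime_left \<omega>) else 0) else None)
      = X_lifetime_left \<omega>" if "\<omega> \<in> space path_space" for \<omega>
  proof (cases "\<omega> \<in> D")
    case True
    then obtain r where r: "lifetime \<omega> = ereal r" "0 < r" "\<omega> \<in> paths"
      by (cases "lifetime \<omega>") (auto simp: D_def)
    obtain l where l: "((\<lambda>s. X s \<omega>) \<longlongrightarrow> l) (at_left r)"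
      using ex_left_limit_at_lifetime[OF r(3,1,2)] by blast
    then show ?thesis using True X_lifetime_left_eqI[OF r(3,1,2) l] by simp
  next
    case False
    then have "X_lifetime_left \<omega> = None"
      using that by (intro X_lifetime_left_None) (auto simp: D_def)
    then show ?thesis using False by simp
  qed
  ultimately show ?thesis by (subst measurable_cong[symmetric])
qed

lemma X_lifetime_left_kill_path:
  assumes "\<omega> \<in> paths" "lifetime \<omega> = \<infinity>" "0 < s" "((\<lambda>t. X t \<omega>) \<longlongrightarrow> X s \<omega>) (at_left s)"
  shows "X_lifetime_left (kill_path s \<omega>) = Some (X s \<omega>)"
proof (rule X_lifetime_left_eqI)
  have "eventually (\<lambda>t. X t \<omega> = X t (kill_path s \<omega>)) (at_left s)"
    using eventually_at_left_real[OF assms(3)]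
    by (auto simp: X_def kill_path_def elim: eventually_mono)
  then show "((\<lambda>t. X t (kill_path s \<omega>)) \<longlongrightarrow> X s \<omega>) (at_left s)"
    using assms(4) by (rule Lim_transform_eventually[rotated])
qed (use assms in \<open>auto simp: kill_path_in_paths lifetime_kill_path\<close>)

text \<open>A monotone function has countably many discontinuities, so at almost every time the path
does not jump and the left limit at the killing time is the current value.\<close>

lemma X_lifetime_left_kill_path_AE:
  assumes "\<omega> \<in> paths" "lifetime \<omega> = \<infinity>" and "\<And>s t. 0 \<le> s \<Longrightarrow> s \<le> t \<Longrightarrow> X s \<omega> \<le> X t \<omega>"
  shows "AE s in lborel. 0 < s \<longrightarrow> X_lifetime_left (kill_path s \<omega>) = Some (X s \<omega>)"
proof -
  have "mono_on {0..} (\<lambda>t. X t \<omega>)" using assms(3) by (auto intro!: mono_onI)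
  then have "countable {s \<in> {0..}. \<not> continuous (at s within {0..}) (\<lambda>t. X t \<omega>)}"
    by (rule mono_on_ctble_discont)
  then have "AE s in lborel. s \<notin> {s \<in> {0..}. \<not> continuous (at s within {0..}) (\<lambda>t. X t \<omega>)}"
    by (intro AE_not_in countable_imp_null_set_lborel)
  then show ?thesis
  proof eventually_elim
    case (elim s)
    show ?case
    proof
      assume s: "0 < s"
      with elim have "((\<lambda>t. X t \<omega>) \<longlongrightarrow> X s \<omega>) (at s within {0..})"
        by (auto simp: continuous_within)
      then have "((\<lambda>t. X t \<omega>) \<longlongrightarrow> X s \<omega>) (at s within {0..s})"
        by (rule tendsto_within_subset) auto
      then show "X_lifetime_left (kill_path s \<omega>) = Some (X s \<omega>)"
        using assms s by (intro X_lifetime_left_kill_path) (auto simp: at_within_Icc_at_left)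
    qed
  qed
qed

section \<open>Markov property and occupation times of a subordinator\<close>

lemma P_eq_distr: "subordinator \<kappa> \<nu> P \<Longrightarrow> P x = distr (P 0) path_space (shift_path x)"
  unfolding subordinator_def by blast

lemma subordinator_levy: "subordinator \<kappa> \<nu> P \<Longrightarrow> levy_process (P 0)"
  unfolding subordinator_def by blast

lemma subordinator_space:
  assumes "subordinator \<kappa> \<nu> P"
  shows "prob_space (P 0)" "sets (P x) = sets path_space" "space (P x) = paths"
proof -
  show "prob_space (P 0)" using subordinator_levy[OF assms] unfolding levy_process_def by blast
  show "sets (P x) = sets path_space" unfolding P_eq_distr[OF assms, of x] by (rule sets_distr)
  then have "space (P x) = space path_space" by (rule sets_eq_imp_space_eq)
  then show "space (P x) = paths" by simp
qed

lemma measurable_P: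
  assumes "subordinator \<kappa> \<nu> P"
  shows "P x \<rightarrow>\<^sub>M N = path_space \<rightarrow>\<^sub>M N"
  by (rule measurable_cong_sets) (simp_all add: subordinator_space[OF assms])

lemma measurable_shift_path_P:
  assumes "subordinator \<kappa> \<nu> P"
  shows "shift_path x \<in> P 0 \<rightarrow>\<^sub>M path_space"
  unfolding measurable_P[OF assms] unfolding path_space_def by (rule measurable_shift_path) simp

lemma prob_space_P:
  assumes "subordinator \<kappa> \<nu> P"
  shows "prob_space (P x)"
  unfolding P_eq_distr[OF assms, of x]
  by (intro prob_space.prob_space_distr subordinator_space(1)[OF assms] measurable_shift_path_P[OF assms])

lemma nn_integral_P:
  assumes "subordinator \<kappa> \<nu> P" "F \<in> borel_measurable path_space"
  shows "(\<integral>\<^sup>+\<omega>. F \<omega> \<partial>P x) = (\<integral>\<^sup>+\<omega>. F (shift_path x \<omega>) \<partial>P 0)"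
  unfolding P_eq_distr[OF assms(1), of x]
  by (rule nn_integral_distr[OF measurable_shift_path_P[OF assms(1)]]) (simp add: assms(2))

text \<open>The almost sure properties are stated for the translates of a path under \<open>P 0\<close>, and not under
\<open>P x\<close>, because the set of monotone paths would have to be shown measurable before they could be
pushed forward; \<open>nn_integral_P_cong\<close> transfers them to integrals under \<open>P x\<close>.\<close>

lemma AE_subordinator:
  assumes "subordinator \<kappa> \<nu> P"
  shows "AE \<omega> in P 0. lifetime (shift_path x \<omega>) = \<infinity> \<and> (\<forall>t\<ge>0. X t (shift_path x \<omega>) = x + X t \<omega>) \<and>
    X 0 (shift_path x \<omega>) = x \<and>
    (\<forall>s t. 0 \<le> s \<longrightarrow> s \<le> t \<longrightarrow> X s (shift_path x \<omega>) \<le> X t (shift_path x \<omega>))"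
proof -
  have "AE \<omega> in P 0. lifetime \<omega> = \<infinity>" "AE \<omega> in P 0. X 0 \<omega> = 0"
    "AE \<omega> in P 0. \<forall>s t. 0 \<le> s \<longrightarrow> s \<le> t \<longrightarrow> X s \<omega> \<le> X t \<omega>"
    using assms unfolding subordinator_def levy_process_def by blast+
  then show ?thesis using AE_space[of "P 0"]
  proof eventually_elim
    case (elim \<omega>)
    then have "\<omega> t \<noteq> None" if "0 \<le> t" for t
      using less_lifetime_iff[of \<omega> t] that by (simp add: subordinator_space[OF assms])
    then have "X t (shift_path x \<omega>) = x + X t \<omega>" if "0 \<le> t" for t
      using that by (intro X_shift_path)
    with elim show ?case by (simp add: lifetime_shift_path)
  qed
qed

lemma AE_P:
  assumes "subordinator \<kappa> \<nu> P"
  shows "AE \<omega> in P x. lifetime \<omega> = \<infinity> \<and> X 0 \<omega> = x"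
  unfolding P_eq_distr[OF assms, of x]
proof (subst AE_distr_iff[OF measurable_shift_path_P[OF assms]])
  have [measurable]: "X 0 \<in> borel_measurable path_space" by (rule measurable_X) simp
  show "{\<omega> \<in> space path_space. lifetime \<omega> = \<infinity> \<and> X 0 \<omega> = x} \<in> sets path_space"
    by measurable
  show "AE \<omega> in P 0. lifetime (shift_path x \<omega>) = \<infinity> \<and> X 0 (shift_path x \<omega>) = x"
    using AE_subordinator[OF assms, of x] by eventually_elim simp
qed

text \<open>Independence of \<open>\<F>\<^sub>t\<close> and the increment makes the joint law of the path, observed up to time
\<open>t\<close>, and the increment a product measure; Tonelli's theorem does the rest. The second factor is the
law of \<open>X\<^sub>s\<close> because increments are stationary.\<close>

lemma nn_integral_increment:
  assumes sub: "subordinator \<kappa> \<nu> P" and st: "0 \<le> s" "0 \<le> t"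
    and F: "F \<in> borel_measurable (filt t \<Otimes>\<^sub>M borel)"
  shows "(\<integral>\<^sup>+\<omega>. F (\<omega>, X (t + s) \<omega> - X t \<omega>) \<partial>P 0) = (\<integral>\<^sup>+\<omega>. \<integral>\<^sup>+\<omega>'. F (\<omega>, X s \<omega>') \<partial>P 0 \<partial>P 0)"
proof -
  interpret prob_space "P 0" using sub by (rule subordinator_space)
  note [simp] = subordinator_space[OF sub] and [measurable_cong] = subordinator_space(2)[OF sub]
  define D where "D \<omega> = X (t + s) \<omega> - X t \<omega>" for \<omega>
  have X: "X r \<in> borel_measurable (P 0)" if "0 \<le> r" for r
    unfolding measurable_P[OF sub] using that by (rule measurable_X)
  have D: "D \<in> borel_measurable (P 0)"
    unfolding D_def[abs_def] using st by (intro borel_measurable_diff X) auto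
  have id: "(\<lambda>\<omega>. \<omega>) \<in> P 0 \<rightarrow>\<^sub>M filt t" unfolding measurable_P[OF sub] by (rule measurable_id_filt)
  have levy: "levy_process (P 0)" using sub by (rule subordinator_levy)
  then have ind: "indep_set (sets (filt t)) {D -` B \<inter> paths | B. B \<in> sets borel}"
    and D_distr: "distr (P 0) borel D = distr (P 0) borel (X s)"
    using st unfolding levy_process_def D_def[abs_def] by blast+
  \<comment> \<open>The two variables take values in different types, so independence is turned into a product
    measure directly on measurable rectangles.\<close>
  interpret D: prob_space "distr (P 0) borel D" using D by (rule prob_space_distr)
  interpret filt: prob_space "distr (P 0) (filt t) (\<lambda>\<omega>. \<omega>)" using id by (rule prob_space_distr)
  have eq: "distr (P 0) (filt t) (\<lambda>\<omega>. \<omega>) \<Otimes>\<^sub>M distr (P 0) borel D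
      = distr (P 0) (filt t \<Otimes>\<^sub>M borel) (\<lambda>\<omega>. (\<omega>, D \<omega>))"
  proof (rule pair_measure_eqI)
    fix A B assume "A \<in> sets (distr (P 0) (filt t) (\<lambda>\<omega>. \<omega>))" "B \<in> sets (distr (P 0) borel D)"
    then have A: "A \<in> sets (filt t)" and B: "B \<in> sets borel" by simp_all
    then have A': "A \<subseteq> paths" "A \<in> events"
      using sets.sets_into_space[OF A] sets_filt_path_space by auto
    have "D -` B \<inter> paths \<in> events" using measurable_sets[OF D B] by simp
    moreover have "prob (A \<inter> (D -` B \<inter> paths)) = prob A * prob (D -` B \<inter> paths)"
      using ind A B unfolding indep_sets2_eq by blast
    ultimately have "emeasure (P 0) A * emeasure (P 0) (D -` B \<inter> paths) = emeasure (P 0) (A \<inter> (D -` B \<inter> paths))"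
      using A' by (simp add: emeasure_eq_measure ennreal_mult)
    moreover have "(\<lambda>\<omega>. (\<omega>, D \<omega>)) -` (A \<times> B) \<inter> paths = A \<inter> (D -` B \<inter> paths)"
      and "(\<lambda>\<omega>. \<omega>) -` A \<inter> paths = A" using A' by auto
    ultimately show "emeasure (distr (P 0) (filt t) (\<lambda>\<omega>. \<omega>)) A * emeasure (distr (P 0) borel D) B
        = emeasure (distr (P 0) (filt t \<Otimes>\<^sub>M borel) (\<lambda>\<omega>. (\<omega>, D \<omega>))) (A \<times> B)"
      using A B D id by (simp add: emeasure_distr)
  qed (unfold_locales, simp_all cong: sets_pair_measure_cong)
  have FF: "F \<in> borel_measurable (distr (P 0) (filt t) (\<lambda>\<omega>. \<omega>) \<Otimes>\<^sub>M distr (P 0) borel D)"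
    using F by (simp cong: measurable_cong_sets)
  have "(\<integral>\<^sup>+\<omega>. F (\<omega>, D \<omega>) \<partial>P 0) = (\<integral>\<^sup>+z. F z \<partial>distr (P 0) (filt t \<Otimes>\<^sub>M borel) (\<lambda>\<omega>. (\<omega>, D \<omega>)))"
    using F id D by (subst nn_integral_distr) auto
  also have "\<dots> = (\<integral>\<^sup>+\<omega>. \<integral>\<^sup>+w. F (\<omega>, w) \<partial>distr (P 0) borel D \<partial>distr (P 0) (filt t) (\<lambda>\<omega>. \<omega>))"
    unfolding eq[symmetric] using FF by (rule D.nn_integral_fst[symmetric])
  also have "\<dots> = (\<integral>\<^sup>+\<omega>. \<integral>\<^sup>+w. F (\<omega>, w) \<partial>distr (P 0) borel D \<partial>P 0)"
    using id FF by (subst nn_integral_distr) (auto intro!: D.borel_measurable_nn_integral_fst)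
  also have "\<dots> = (\<integral>\<^sup>+\<omega>. \<integral>\<^sup>+\<omega>'. F (\<omega>, X s \<omega>') \<partial>P 0 \<partial>P 0)"
    unfolding D_distr
  proof (rule nn_integral_cong)
    fix \<omega> assume "\<omega> \<in> space (P 0)"
    then have "(\<lambda>w. F (\<omega>, w)) \<in> borel_measurable borel"
      using F by (intro measurable_compose[OF measurable_Pair1' F]) simp
    then show "(\<integral>\<^sup>+w. F (\<omega>, w) \<partial>distr (P 0) borel (X s)) = (\<integral>\<^sup>+\<omega>'. F (\<omega>, X s \<omega>') \<partial>P 0)"
      using X[OF st(1)] by (subst nn_integral_distr) auto
  qed
  finally show ?thesis by (simp add: D_def)
qed

lemma markov_property:
  assumes sub: "subordinator \<kappa> \<nu> P" and st: "0 \<le> s" "0 \<le> t"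
    and H: "H \<in> borel_measurable (filt t)" and g: "g \<in> borel_measurable borel"
  shows "(\<integral>\<^sup>+\<omega>. H \<omega> * g (X (t + s) \<omega>) \<partial>P x)
    = (\<integral>\<^sup>+\<omega>. H \<omega> * (\<integral>\<^sup>+\<omega>'. g (X t \<omega> + X s \<omega>') \<partial>P 0) \<partial>P x)"
proof -
  note X = measurable_X
  interpret prob_space "P 0" using sub by (rule subordinator_space)
  have H': "H \<in> borel_measurable path_space" using measurable_compose[OF measurable_id_filt H] .
  have Hs: "(\<lambda>\<omega>. H (shift_path x \<omega>)) \<in> borel_measurable (filt t)"
    using measurable_compose[OF measurable_shift_path H[unfolded filt_def]] by (simp add: filt_def)
  have Xt: "X t \<in> borel_measurable (filt t)" using st by (intro measurable_X_filt) auto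
  have ae: "AE \<omega> in P 0. (\<forall>t\<ge>0. X t (shift_path x \<omega>) = x + X t \<omega>)"
    using AE_subordinator[OF sub, of x] by eventually_elim simp
  have g1: "(\<lambda>\<omega>'. g (r + X s \<omega>')) \<in> borel_measurable (P 0)" for r
    unfolding measurable_P[OF sub]
    by (intro measurable_compose[OF _ g] borel_measurable_add X st borel_measurable_const)
  have pair: "(\<lambda>(\<omega>, \<omega>'). g (X t \<omega> + X s \<omega>')) \<in> borel_measurable (path_space \<Otimes>\<^sub>M P 0)"
    unfolding measurable_cong_sets[OF sets_pair_measure_cong[OF refl subordinator_space(2)[OF sub]] refl] case_prod_beta
    by (intro measurable_compose[OF _ g] borel_measurable_add
         measurable_compose[OF measurable_fst] measurable_compose[OF measurable_snd] X st)
  have g2: "(\<lambda>\<omega>. \<integral>\<^sup>+\<omega>'. g (X t \<omega> + X s \<omega>') \<partial>P 0) \<in> borel_measurable path_space"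
    using borel_measurable_nn_integral[OF pair] .
  have "(\<integral>\<^sup>+\<omega>. H \<omega> * g (X (t + s) \<omega>) \<partial>P x)
     = (\<integral>\<^sup>+\<omega>. H (shift_path x \<omega>) * g (X (t + s) (shift_path x \<omega>)) \<partial>P 0)"
    using st by (intro nn_integral_P[OF sub] borel_measurable_times_ennreal H' measurable_compose[OF _ g] X) auto
  also have "\<dots> = (\<integral>\<^sup>+\<omega>. (\<lambda>(\<omega>, w). H (shift_path x \<omega>) * g (x + X t \<omega> + w)) (\<omega>, X (t + s) \<omega> - X t \<omega>) \<partial>P 0)"
    using ae st by (intro nn_integral_cong_AE) (auto elim!: eventually_mono simp: algebra_simps)
  also have "\<dots> = (\<integral>\<^sup>+\<omega>. \<integral>\<^sup>+\<omega>'. (\<lambda>(\<omega>, w). H (shift_path x \<omega>) * g (x + X t \<omega> + w)) (\<omega>, X s \<omega>') \<partial>P 0 \<partial>P 0)"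
    unfolding case_prod_beta
    by (intro nn_integral_increment[OF sub st] borel_measurable_times_ennreal measurable_compose[OF _ g]
       borel_measurable_add measurable_compose[OF measurable_fst Hs] measurable_compose[OF measurable_fst Xt]) auto
  also have "\<dots> = (\<integral>\<^sup>+\<omega>. H (shift_path x \<omega>) * (\<integral>\<^sup>+\<omega>'. g (X t (shift_path x \<omega>) + X s \<omega>') \<partial>P 0) \<partial>P 0)"
    using ae by (intro nn_integral_cong_AE)
      (auto elim!: eventually_mono simp: st nn_integral_cmult[OF g1])
  also have "\<dots> = (\<integral>\<^sup>+\<omega>. H \<omega> * (\<integral>\<^sup>+\<omega>'. g (X t \<omega> + X s \<omega>') \<partial>P 0) \<partial>P x)"
    by (intro nn_integral_P[OF sub, symmetric] borel_measurable_times_ennreal H' g2)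
  finally show ?thesis .
qed

lemma measurable_X_pair_P:
  assumes "subordinator \<kappa> \<nu> P"
  shows "(\<lambda>(s, \<omega>). X (max 0 s) \<omega>) \<in> borel_measurable (lborel \<Otimes>\<^sub>M P x)"
proof -
  have "sets (borel \<Otimes>\<^sub>M path_space) = sets (lborel \<Otimes>\<^sub>M P x)"
    by (intro sets_pair_measure_cong) (simp_all add: subordinator_space[OF assms])
  moreover have "(\<lambda>(s, \<omega>). X (max 0 s) \<omega>) \<in> borel_measurable (borel \<Otimes>\<^sub>M path_space)"
    using measurable_compose[OF measurable_pair_swap' measurable_X_pair] by (simp add: case_prod_beta)
  ultimately show ?thesis using measurable_cong_sets[OF _ refl] by blast
qed

lemma nn_integral_indicator_X:
  assumes sub: "subordinator \<kappa> \<nu> P" and s: "0 \<le> s" and B: "B \<in> sets borel"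
  shows "(\<integral>\<^sup>+\<omega>. indicator B (X s \<omega>) \<partial>P 0) = emeasure (P 0) {\<omega> \<in> paths. X s \<omega> \<in> B}"
proof -
  have "{\<omega> \<in> paths. X s \<omega> \<in> B} \<in> sets (P 0)"
    using measurable_sets[OF measurable_X[OF s] B]
    by (simp add: subordinator_space[OF sub] vimage_def Int_def conj_commute)
  then have "emeasure (P 0) {\<omega> \<in> paths. X s \<omega> \<in> B} = (\<integral>\<^sup>+\<omega>. indicator {\<omega> \<in> paths. X s \<omega> \<in> B} \<omega> \<partial>P 0)"
    by simp
  also have "\<dots> = (\<integral>\<^sup>+\<omega>. indicator B (X s \<omega>) \<partial>P 0)"
    by (intro nn_integral_cong) (simp add: subordinator_space[OF sub] indicator_def)
  finally show ?thesis by simp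
qed

text \<open>The potential measure is the image of \<open>ds \<otimes> P 0\<close>, restricted to \<open>s \<ge> 0\<close>, under
\<open>(s, \<omega>) \<mapsto> X\<^sub>s(\<omega>)\<close>. In particular the set function in its definition is countably additive, so
that \<open>measure_of\<close> returns the intended measure.\<close>

lemma nn_integral_potential:
  assumes sub: "subordinator \<kappa> \<nu> P" and g: "g \<in> borel_measurable borel"
  shows "(\<integral>\<^sup>+w. g w \<partial>potential P) = (\<integral>\<^sup>+s\<in>{0..}. (\<integral>\<^sup>+\<omega>. g (X s \<omega>) \<partial>P 0) \<partial>lborel)"
proof -
  interpret prob_space "P 0" using sub by (rule subordinator_space)
  define Q where "Q = distr (density (lborel \<Otimes>\<^sub>M P 0) (\<lambda>(s, \<omega>). indicator {0..} s)) borel (\<lambda>(s, \<omega>). X (max 0 s) \<omega>)"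
  note Xm [measurable] = measurable_X_pair_P[OF sub, of 0]
  have Q: "(\<integral>\<^sup>+w. f w \<partial>Q) = (\<integral>\<^sup>+s\<in>{0..}. (\<integral>\<^sup>+\<omega>. f (X s \<omega>) \<partial>P 0) \<partial>lborel)"
    if f: "f \<in> borel_measurable borel" for f
  proof -
    note f [measurable]
    have m: "(\<lambda>z. indicator {0..} (fst z) * f (case z of (s, \<omega>) \<Rightarrow> X (max 0 s) \<omega>)) \<in> borel_measurable (lborel \<Otimes>\<^sub>M P 0)"
      by (intro borel_measurable_times_ennreal measurable_compose[OF Xm f]) measurable
    have m1: "(\<lambda>\<omega>. f (X s \<omega>)) \<in> borel_measurable (P 0)" if "0 \<le> s" for s
      unfolding measurable_P[OF sub] using that by (intro measurable_compose[OF _ f] measurable_X)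
    have "(\<integral>\<^sup>+w. f w \<partial>Q) = (\<integral>\<^sup>+z. indicator {0..} (fst z) * f (case z of (s, \<omega>) \<Rightarrow> X (max 0 s) \<omega>) \<partial>(lborel \<Otimes>\<^sub>M P 0))"
      unfolding Q_def by (subst nn_integral_distr) (simp_all add: nn_integral_density case_prod_beta')
    also have "\<dots> = (\<integral>\<^sup>+s. \<integral>\<^sup>+\<omega>. indicator {0..} s * f (X (max 0 s) \<omega>) \<partial>P 0 \<partial>lborel)"
      using nn_integral_fst[OF m] by simp
    also have "\<dots> = (\<integral>\<^sup>+s\<in>{0..}. (\<integral>\<^sup>+\<omega>. f (X s \<omega>) \<partial>P 0) \<partial>lborel)"
      by (intro nn_integral_cong) (auto simp: indicator_def max_def)
    finally show ?thesis .
  qed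
  have "potential P = measure_of UNIV (sets borel) (emeasure Q)"
    unfolding potential_def
  proof (rule measure_of_eq)
    fix B :: "real set" assume "B \<in> sigma_sets UNIV (sets borel)"
    then have B: "B \<in> sets borel" using sets.sigma_sets_eq[of "borel :: real measure"] by simp
    have "emeasure Q B = (\<integral>\<^sup>+w. indicator B w \<partial>Q)" using B by (simp add: Q_def)
    also have "\<dots> = (\<integral>\<^sup>+s\<in>{0..}. (\<integral>\<^sup>+\<omega>. indicator B (X s \<omega>) \<partial>P 0) \<partial>lborel)" using B by (intro Q) simp
    also have "\<dots> = (\<integral>\<^sup>+s\<in>{0..}. emeasure (P 0) {\<omega> \<in> paths. X s \<omega> \<in> B} \<partial>lborel)"
    proof (intro nn_integral_cong)
      fix s :: real
      show "(\<integral>\<^sup>+\<omega>. indicator B (X s \<omega>) \<partial>P 0) * indicator {0..} s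
        = emeasure (P 0) {\<omega> \<in> paths. X s \<omega> \<in> B} * indicator {0..} s"
        using nn_integral_indicator_X[OF sub _ B, of s] by (cases "0 \<le> s") auto
    qed
    finally show "(\<integral>\<^sup>+s\<in>{0..}. emeasure (P 0) {\<omega> \<in> paths. X s \<omega> \<in> B} \<partial>lborel) = emeasure Q B" by simp
  qed auto
  also have "\<dots> = Q" using measure_of_of_measure[of Q] by (simp add: Q_def)
  finally show ?thesis using Q[OF g] by simp
qed

text \<open>The Markov property at time \<open>t\<close>, integrated over all later times: given \<open>\<F>\<^sub>t\<close>, the expected
occupation measure of the future is the potential measure translated to \<open>X\<^sub>t\<close>.\<close>

lemma occupation_formula:
  assumes sub: "subordinator \<kappa> \<nu> P" and t: "0 \<le> t"
    and H: "H \<in> borel_measurable (filt t)" and g: "g \<in> borel_measurable borel"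
  shows "(\<integral>\<^sup>+\<omega>. H \<omega> * (\<integral>\<^sup>+s\<in>{t..}. g (X s \<omega>) \<partial>lborel) \<partial>P x)
    = (\<integral>\<^sup>+\<omega>. H \<omega> * (\<integral>\<^sup>+w. g (X t \<omega> + w) \<partial>potential P) \<partial>P x)"
proof -
  interpret P0: prob_space "P 0" using sub by (rule subordinator_space)
  interpret Px: prob_space "P x" using sub by (rule prob_space_P)
  interpret pair_sigma_finite lborel "P x" by unfold_locales
  have H': "H \<in> borel_measurable (P x)"
    unfolding measurable_P[OF sub] using measurable_compose[OF measurable_id_filt H] .
  have Xt: "X t \<in> borel_measurable (P x)" unfolding measurable_P[OF sub] using t by (rule measurable_X)
  note Xm = measurable_X_pair_P[OF sub]
  have Xs: "(\<lambda>s. X (max 0 s) \<omega>) \<in> borel_measurable lborel" if "\<omega> \<in> paths" for \<omega>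
    using measurable_compose[OF measurable_Pair2' Xm[of 0], of \<omega>] that
    by (simp add: subordinator_space[OF sub])
  have "(\<integral>\<^sup>+\<omega>. H \<omega> * (\<integral>\<^sup>+s\<in>{t..}. g (X s \<omega>) \<partial>lborel) \<partial>P x)
    = (\<integral>\<^sup>+\<omega>. \<integral>\<^sup>+s. indicator {0..} s * (H \<omega> * g (X (max 0 (t + s)) \<omega>)) \<partial>lborel \<partial>P x)"
  proof (rule nn_integral_cong)
    fix \<omega> assume "\<omega> \<in> space (P x)"
    then have \<omega>: "\<omega> \<in> paths" by (simp add: subordinator_space[OF sub])
    have m: "(\<lambda>s. indicator {t..} s * g (X (max 0 s) \<omega>)) \<in> borel_measurable lborel"
      by (intro borel_measurable_times_ennreal measurable_compose[OF Xs[OF \<omega>] g]) auto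
    have "(\<integral>\<^sup>+s\<in>{t..}. g (X s \<omega>) \<partial>lborel) = (\<integral>\<^sup>+s. indicator {t..} s * g (X (max 0 s) \<omega>) \<partial>lborel)"
      using t by (intro nn_integral_cong) (auto simp: indicator_def max_def)
    also have "\<dots> = (\<integral>\<^sup>+s. indicator {t..} (t + s) * g (X (max 0 (t + s)) \<omega>) \<partial>lborel)"
      using nn_integral_real_affine[of "\<lambda>s. indicator {t..} s * g (X (max 0 s) \<omega>)" 1 t] m by simp
    also have "\<dots> = (\<integral>\<^sup>+s. indicator {0..} s * g (X (max 0 (t + s)) \<omega>) \<partial>lborel)"
      by (intro nn_integral_cong) (auto simp: indicator_def)
    finally have eq: "(\<integral>\<^sup>+s\<in>{t..}. g (X s \<omega>) \<partial>lborel) = \<dots>" .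
    have "(\<lambda>s. X (max 0 (t + s)) \<omega>) \<in> borel_measurable lborel"
      using measurable_compose[of "\<lambda>s. t + s" lborel lborel, OF _ Xs[OF \<omega>]] by simp
    then have "(\<lambda>s. indicator {0..} s * g (X (max 0 (t + s)) \<omega>)) \<in> borel_measurable lborel"
      by (intro borel_measurable_times_ennreal measurable_compose[OF _ g]) auto
    from nn_integral_cmult[OF this, of "H \<omega>"]
    show "H \<omega> * (\<integral>\<^sup>+s\<in>{t..}. g (X s \<omega>) \<partial>lborel)
       = (\<integral>\<^sup>+s. indicator {0..} s * (H \<omega> * g (X (max 0 (t + s)) \<omega>)) \<partial>lborel)"
      unfolding eq by (simp add: mult_ac)
  qed
  also have "\<dots> = (\<integral>\<^sup>+s. \<integral>\<^sup>+\<omega>. indicator {0..} s * (H \<omega> * g (X (max 0 (t + s)) \<omega>)) \<partial>P x \<partial>lborel)"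
  proof (rule Fubini')
    have "(\<lambda>z. (t + fst z, snd z)) \<in> lborel \<Otimes>\<^sub>M P x \<rightarrow>\<^sub>M lborel \<Otimes>\<^sub>M P x" by measurable
    from measurable_compose[OF this Xm]
    have "(\<lambda>z. X (max 0 (t + fst z)) (snd z)) \<in> borel_measurable (lborel \<Otimes>\<^sub>M P x)" by simp
    then show "(\<lambda>(s, \<omega>). indicator {0..} s * (H \<omega> * g (X (max 0 (t + s)) \<omega>))) \<in> borel_measurable (lborel \<Otimes>\<^sub>M P x)"
      unfolding case_prod_beta
      by (intro borel_measurable_times_ennreal measurable_compose[OF measurable_snd H']
         measurable_compose[OF _ g] measurable_compose[OF measurable_fst]) auto
  qed
  also have "\<dots> = (\<integral>\<^sup>+s. \<integral>\<^sup>+\<omega>. indicator {0..} s * (H \<omega> * (\<integral>\<^sup>+\<omega>'. g (X t \<omega> + X (max 0 s) \<omega>') \<partial>P 0)) \<partial>P x \<partial>lborel)"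
  proof (rule nn_integral_cong)
    fix s :: real
    show "(\<integral>\<^sup>+\<omega>. indicator {0..} s * (H \<omega> * g (X (max 0 (t + s)) \<omega>)) \<partial>P x)
       = (\<integral>\<^sup>+\<omega>. indicator {0..} s * (H \<omega> * (\<integral>\<^sup>+\<omega>'. g (X t \<omega> + X (max 0 s) \<omega>') \<partial>P 0)) \<partial>P x)"
      using markov_property[OF sub _ t H g, of s x] t by (cases "0 \<le> s") (simp_all add: max_def)
  qed
  also have "\<dots> = (\<integral>\<^sup>+\<omega>. \<integral>\<^sup>+s. indicator {0..} s * (H \<omega> * (\<integral>\<^sup>+\<omega>'. g (X t \<omega> + X (max 0 s) \<omega>') \<partial>P 0)) \<partial>lborel \<partial>P x)"
  proof (rule Fubini'[symmetric])
    have "(\<lambda>z. (fst (fst z), snd z)) \<in> (lborel \<Otimes>\<^sub>M P x) \<Otimes>\<^sub>M P 0 \<rightarrow>\<^sub>M lborel \<Otimes>\<^sub>M P 0" by measurable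
    from measurable_compose[OF this Xm]
    have "(\<lambda>z. X (max 0 (fst (fst z))) (snd z)) \<in> borel_measurable ((lborel \<Otimes>\<^sub>M P x) \<Otimes>\<^sub>M P 0)" by simp
    then have "(\<lambda>(z, \<omega>'). g (X t (snd z) + X (max 0 (fst z)) \<omega>')) \<in> borel_measurable ((lborel \<Otimes>\<^sub>M P x) \<Otimes>\<^sub>M P 0)"
      unfolding case_prod_beta
      by (intro measurable_compose[OF _ g] borel_measurable_add measurable_compose[OF measurable_fst]
          measurable_compose[OF measurable_snd Xt])
    from P0.borel_measurable_nn_integral[OF this]
    show "(\<lambda>(s, \<omega>). indicator {0..} s * (H \<omega> * (\<integral>\<^sup>+\<omega>'. g (X t \<omega> + X (max 0 s) \<omega>') \<partial>P 0))) \<in> borel_measurable (lborel \<Otimes>\<^sub>M P x)"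
      unfolding case_prod_beta
      by (intro borel_measurable_times_ennreal measurable_compose[OF measurable_snd H']
         measurable_compose[OF measurable_fst]) auto
  qed
  also have "\<dots> = (\<integral>\<^sup>+\<omega>. H \<omega> * (\<integral>\<^sup>+w. g (X t \<omega> + w) \<partial>potential P) \<partial>P x)"
  proof (rule nn_integral_cong)
    fix \<omega>
    have "(\<lambda>(s, \<omega>'). g (X t \<omega> + X (max 0 s) \<omega>')) \<in> borel_measurable (lborel \<Otimes>\<^sub>M P 0)"
      using Xm[of 0] unfolding case_prod_beta
      by (intro measurable_compose[OF _ g] borel_measurable_add) auto
    from P0.borel_measurable_nn_integral[OF this]
    have "(\<lambda>s. indicator {0..} s * (\<integral>\<^sup>+\<omega>'. g (X t \<omega> + X (max 0 s) \<omega>') \<partial>P 0)) \<in> borel_measurable lborel"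
      by (intro borel_measurable_times_ennreal) auto
    from nn_integral_cmult[OF this, of "H \<omega>"]
    have "(\<integral>\<^sup>+s. indicator {0..} s * (H \<omega> * (\<integral>\<^sup>+\<omega>'. g (X t \<omega> + X (max 0 s) \<omega>') \<partial>P 0)) \<partial>lborel)
      = H \<omega> * (\<integral>\<^sup>+s. indicator {0..} s * (\<integral>\<^sup>+\<omega>'. g (X t \<omega> + X (max 0 s) \<omega>') \<partial>P 0) \<partial>lborel)"
      by (simp add: mult_ac)
    also have "(\<integral>\<^sup>+s. indicator {0..} s * (\<integral>\<^sup>+\<omega>'. g (X t \<omega> + X (max 0 s) \<omega>') \<partial>P 0) \<partial>lborel)
      = (\<integral>\<^sup>+w. g (X t \<omega> + w) \<partial>potential P)"
      by (subst nn_integral_potential[OF sub]) (auto intro!: nn_integral_cong measurable_compose[OF _ g] simp: indicator_def max_def)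
    finally show "(\<integral>\<^sup>+s. indicator {0..} s * (H \<omega> * (\<integral>\<^sup>+\<omega>'. g (X t \<omega> + X (max 0 s) \<omega>') \<partial>P 0)) \<partial>lborel)
      = H \<omega> * (\<integral>\<^sup>+w. g (X t \<omega> + w) \<partial>potential P)" .
  qed
  finally show ?thesis .
qed

text \<open>Both integrals are pulled back to \<open>P 0\<close>, where the almost sure properties are available.\<close>

lemma nn_integral_P_cong:
  assumes sub: "subordinator \<kappa> \<nu> P"
    and F: "F \<in> borel_measurable path_space" and F': "F' \<in> borel_measurable path_space"
    and eq: "\<And>\<omega>. \<omega> \<in> paths \<Longrightarrow> lifetime \<omega> = \<infinity> \<Longrightarrow> X 0 \<omega> = x \<Longrightarrow>
        (\<And>s t. 0 \<le> s \<Longrightarrow> s \<le> t \<Longrightarrow> X s \<omega> \<le> X t \<omega>) \<Longrightarrow> F \<omega> = F' \<omega>"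
  shows "(\<integral>\<^sup>+\<omega>. F \<omega> \<partial>P x) = (\<integral>\<^sup>+\<omega>. F' \<omega> \<partial>P x)"
  unfolding nn_integral_P[OF sub F] nn_integral_P[OF sub F']
proof (rule nn_integral_cong_AE)
  show "AE \<omega> in P 0. F (shift_path x \<omega>) = F' (shift_path x \<omega>)"
    using AE_subordinator[OF sub, of x] AE_space[of "P 0"]
  proof eventually_elim
    case (elim \<omega>)
    show ?case
    proof (rule eq)
      show "shift_path x \<omega> \<in> paths"
        using elim by (intro shift_path_in_paths) (simp add: subordinator_space[OF sub])
    qed (use elim in blast)+
  qed
qed

section \<open>Events before the lifetime determine a law\<close>

text \<open>The events \<open>A \<inter> {t < \<zeta>}\<close> with \<open>A \<in> \<F>\<^sub>t\<close>, on which the killed laws are prescribed.\<close>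

definition alive_events :: "path set set" where
  "alive_events = {{\<omega> \<in> A. ereal t < lifetime \<omega>} | t A. 0 \<le> t \<and> A \<in> sets (filt t)}"

lemma alive_events_subset: "alive_events \<subseteq> sets path_space"
  using sets_filt_lifetime sets_filt_path_space unfolding alive_events_def by blast

lemma alive_events_Pow: "alive_events \<subseteq> Pow paths"
  using alive_events_subset sets.space_closed[of path_space] by auto

lemma Int_stable_alive_events: "Int_stable alive_events"
proof (rule Int_stableI)
  have *: "{\<omega> \<in> A. ereal s < lifetime \<omega>} \<inter> {\<omega> \<in> B. ereal t < lifetime \<omega>} \<in> alive_events"
    if "0 \<le> s" "s \<le> t" "A \<in> sets (filt s)" "B \<in> sets (filt t)" for s t A B
  proof -
    have "A \<inter> B \<in> sets (filt t)" using sets_filt_subset[OF that(2)] that by blast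
    moreover have "{\<omega> \<in> A. ereal s < lifetime \<omega>} \<inter> {\<omega> \<in> B. ereal t < lifetime \<omega>}
        = {\<omega> \<in> A \<inter> B. ereal t < lifetime \<omega>}"
    proof -
      have "ereal s < lifetime \<omega>" if "ereal t < lifetime \<omega>" for \<omega>
        using le_less_trans[of "ereal s" "ereal t"] that \<open>s \<le> t\<close> by simp
      then show ?thesis by blast
    qed
    moreover have "0 \<le> t" using that by simp
    ultimately show ?thesis unfolding alive_events_def by blast
  qed
  fix E F assume "E \<in> alive_events" "F \<in> alive_events"
  then obtain s A t B where "0 \<le> s" "A \<in> sets (filt s)" "E = {\<omega> \<in> A. ereal s < lifetime \<omega>}"
    "0 \<le> t" "B \<in> sets (filt t)" "F = {\<omega> \<in> B. ereal t < lifetime \<omega>}"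
    unfolding alive_events_def by blast
  then have "s \<le> t \<Longrightarrow> E \<inter> F \<in> alive_events" "t \<le> s \<Longrightarrow> F \<inter> E \<in> alive_events"
    using *[of s t A B] *[of t s B A] by blast+
  then show "E \<inter> F \<in> alive_events" unfolding Int_commute[of F E] using linear[of s t] by blast
qed

text \<open>A coordinate event at time \<open>t\<close> is an event before the lifetime, up to the event
\<open>{\<zeta> \<le> t}\<close>, which is the complement of one.\<close>

lemma sets_path_space_alive: "sets path_space = sigma_sets paths alive_events"
proof
  show "sigma_sets paths alive_events \<subseteq> sets path_space"
    using sets.sigma_sets_subset[OF alive_events_subset] by simp
  have alive: "{\<omega> \<in> A. ereal t < lifetime \<omega>} \<in> sigma_sets paths alive_events"
    if "0 \<le> t" "A \<in> sets (filt t)" for t A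
    using that unfolding alive_events_def by (intro sigma_sets.Basic) blast
  show "sets path_space \<subseteq> sigma_sets paths alive_events"
    unfolding path_space_def sets_coord_algebra
  proof (rule sigma_sets_mono, rule subsetI)
    fix E assume "E \<in> {{\<omega> \<in> paths. \<omega> t \<in> C} |t C. t \<in> {0..} \<and> C \<in> sets cemetery_borel}"
    then obtain t C where t: "0 \<le> t" and C: "C \<in> sets cemetery_borel" and E: "E = {\<omega> \<in> paths. \<omega> t \<in> C}"
      by auto
    have "E \<in> sets (filt t)"
      unfolding E filt_def sets_coord_algebra using t C by (intro sigma_sets.Basic) auto
    then have 1: "{\<omega> \<in> E. ereal t < lifetime \<omega>} \<in> sigma_sets paths alive_events"
      using t by (rule alive[rotated])
    have 2: "paths - {\<omega> \<in> paths. ereal t < lifetime \<omega>} \<in> sigma_sets paths alive_events"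
      using t by (intro sigma_sets.Compl alive) simp_all
    have "E = {\<omega> \<in> E. ereal t < lifetime \<omega>} \<union>
        (if None \<in> C then paths - {\<omega> \<in> paths. ereal t < lifetime \<omega>} else {})"
    proof (rule set_eqI)
      fix \<omega>
      show "\<omega> \<in> E \<longleftrightarrow> \<omega> \<in> {\<omega> \<in> E. ereal t < lifetime \<omega>} \<union>
        (if None \<in> C then paths - {\<omega> \<in> paths. ereal t < lifetime \<omega>} else {})"
      proof (cases "\<omega> \<in> paths")
        case True
        then show ?thesis
          using less_lifetime_iff[OF True t] unfolding E by (cases "\<omega> t") simp_all
      qed (simp add: E)
    qed
    also have "\<dots> \<in> sigma_sets paths alive_events"
      using 1 2 by (intro sigma_sets_Un) (auto intro: sigma_sets.Empty)
    finally show "E \<in> sigma_sets paths alive_events" .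
  qed
qed

text \<open>The whole space need not be a countable union of events before the lifetime, since a path may
start in \<open>\<Delta>\<close>. Equal total mass makes up for this: the whole space is added to the generator.\<close>

lemma path_law_eqI:
  assumes M: "prob_space M" "sets M = sets path_space" and N: "prob_space N" "sets N = sets path_space"
    and eq: "\<And>E. E \<in> alive_events \<Longrightarrow> emeasure M E = emeasure N E"
  shows "M = N"
proof (rule measure_eqI_generator_eq)
  show "Int_stable (insert paths alive_events)"
    unfolding Int_stable_def
  proof (intro ballI)
    fix E F assume "E \<in> insert paths alive_events" "F \<in> insert paths alive_events"
    then consider "E = paths" "F \<subseteq> paths" | "F = paths" "E \<subseteq> paths" | "E \<in> alive_events" "F \<in> alive_events"
      using alive_events_Pow by blast
    then show "E \<inter> F \<in> insert paths alive_events"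
    proof cases
      case 3
      then show ?thesis using Int_stableD[OF Int_stable_alive_events] by blast
    qed (use \<open>E \<in> _\<close> \<open>F \<in> _\<close> in \<open>simp_all add: Int_absorb1 Int_absorb2\<close>)
  qed
  have sp: "space M = paths" "space N = paths"
    using sets_eq_imp_space_eq[OF M(2)] sets_eq_imp_space_eq[OF N(2)] by simp_all
  show "insert paths alive_events \<subseteq> Pow paths" using alive_events_Pow by auto
  have "sigma_sets paths (insert paths alive_events) = sigma_sets paths alive_events"
    by (rule sigma_sets_eqI) (auto intro: sigma_sets_top sigma_sets.Basic)
  then show "sets M = sigma_sets paths (insert paths alive_events)"
    and "sets N = sigma_sets paths (insert paths alive_events)"
    using M N sets_path_space_alive by simp_all
  show "range (\<lambda>_::nat. paths) \<subseteq> insert paths alive_events" "(\<Union>i::nat. paths) = paths" by auto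
  have 1: "emeasure M paths = 1" "emeasure N paths = 1"
    using prob_space.emeasure_space_1[OF M(1)] prob_space.emeasure_space_1[OF N(1)] sp by simp_all
  then show "emeasure M paths \<noteq> \<infinity>" by simp
  show "emeasure M E = emeasure N E" if "E \<in> insert paths alive_events" for E
    using that 1 eq by auto
qed

section \<open>Densities of occupation measures\<close>

definition potential_density :: "(real \<Rightarrow> real) \<Rightarrow> real \<Rightarrow> ennreal" where
  "potential_density u z = ennreal (u z) * indicator {0<..} z"

lemma measurable_potential_density:
  assumes "continuous_potential_density P u"
  shows "potential_density u \<in> borel_measurable borel"
proof -
  have "(\<lambda>z. ennreal (indicator {0<..} z *\<^sub>R u z)) \<in> borel_measurable borel"
    using assms unfolding continuous_potential_density_def
    by (intro measurable_compose[OF _ measurable_ennreal] borel_measurable_continuous_on_indicator) auto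
  also have "(\<lambda>z. ennreal (indicator {0<..} z *\<^sub>R u z)) = potential_density u"
    by (auto simp: potential_density_def indicator_def)
  finally show ?thesis .
qed

lemma nn_integral_potential_shift:
  assumes u: "continuous_potential_density P u" and g: "g \<in> borel_measurable borel"
  shows "(\<integral>\<^sup>+w. g (r + w) \<partial>potential P) = (\<integral>\<^sup>+y. g y * potential_density u (y - r) \<partial>lborel)"
proof -
  note v = measurable_potential_density[OF u]
  have m: "(\<lambda>y. g y * potential_density u (y - r)) \<in> borel_measurable borel"
    by (intro borel_measurable_times_ennreal g measurable_compose[OF _ v]) auto
  have "potential P = density lborel (potential_density u)"
    using u unfolding continuous_potential_density_def potential_density_def[abs_def] by blast
  then have "(\<integral>\<^sup>+w. g (r + w) \<partial>potential P) = (\<integral>\<^sup>+w. potential_density u w * g (r + w) \<partial>lborel)"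
    using v g by (simp add: nn_integral_density measurable_compose[OF _ g])
  also have "\<dots> = (\<integral>\<^sup>+w. g (r + w) * potential_density u (r + w - r) \<partial>lborel)"
    by (simp add: mult.commute)
  also have "\<dots> = (\<integral>\<^sup>+y. g y * potential_density u (y - r) \<partial>lborel)"
    using nn_integral_real_affine[OF m, of 1 r] by simp
  finally show ?thesis .
qed

text \<open>The value at \<open>r\<close> is the mean time spent below \<open>a\<close> by the subordinator started from \<open>r\<close>. The
renewal function counts time in \<open>(-\<infinity>, a]\<close> instead, which is the same because the potential measure
has no atoms; and both sides vanish for \<open>r \<ge> a\<close> because it lives on \<open>(0, \<infinity>)\<close>.\<close>

lemma renewal_eq_potential:
  assumes sub: "subordinator \<kappa> \<nu> P" and u: "continuous_potential_density P u"
  shows "renewal P (a - r) * indicator {..<a} r = (\<integral>\<^sup>+w. indicator {..<a} (r + w) \<partial>potential P)"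
proof -
  have "renewal P z = (\<integral>\<^sup>+w. indicator {..z} w \<partial>potential P)" for z
  proof -
    have "(\<integral>\<^sup>+w. indicator {..z} w \<partial>potential P) = (\<integral>\<^sup>+s\<in>{0..}. (\<integral>\<^sup>+\<omega>. indicator {..z} (X s \<omega>) \<partial>P 0) \<partial>lborel)"
      using sub by (rule nn_integral_potential) simp
    also have "\<dots> = renewal P z"
      unfolding renewal_def
    proof (rule nn_integral_cong)
      fix s :: real
      show "(\<integral>\<^sup>+\<omega>. indicator {..z} (X s \<omega>) \<partial>P 0) * indicator {0..} s
        = emeasure (P 0) {\<omega> \<in> paths. X s \<omega> \<le> z} * indicator {0..} s"
        using nn_integral_indicator_X[OF sub, of s "{..z}"] by (cases "0 \<le> s") auto
    qed
    finally show ?thesis by simp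
  qed
  note eq = this
  have "renewal P (a - r) = (\<integral>\<^sup>+w. indicator {..a} (r + w) \<partial>potential P)"
    unfolding eq by (intro nn_integral_cong) (auto simp: indicator_def)
  also have "\<dots> = (\<integral>\<^sup>+y. indicator {..a} y * potential_density u (y - r) \<partial>lborel)"
    using u by (rule nn_integral_potential_shift) simp
  also have "\<dots> = (\<integral>\<^sup>+y. indicator {..<a} y * potential_density u (y - r) \<partial>lborel)"
    using AE_lborel_singleton[of a]
    by (intro nn_integral_cong_AE) (auto elim!: eventually_mono simp: indicator_def)
  finally have 1: "renewal P (a - r) = \<dots>" .
  have 2: "(\<integral>\<^sup>+w. indicator {..<a} (r + w) \<partial>potential P) = (\<integral>\<^sup>+y. indicator {..<a} y * potential_density u (y - r) \<partial>lborel)"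
    using u by (rule nn_integral_potential_shift) simp
  show ?thesis
  proof (cases "r < a")
    case True
    then show ?thesis using 1 2 by simp
  next
    case False
    then have "(\<integral>\<^sup>+y. indicator {..<a} y * potential_density u (y - r) \<partial>lborel) = (\<integral>\<^sup>+y. 0 \<partial>(lborel :: real measure))"
      by (intro nn_integral_cong) (auto simp: potential_density_def indicator_def)
    then show ?thesis using 2 False by simp
  qed
qed

text \<open>The density at \<open>y\<close> of the occupation measure \<open>C \<mapsto> E\<^sub>x[\<one>\<^sub>A \<integral>\<^sub>t\<^sup>\<infinity> \<one>{X\<^sub>s \<in> C} ds]\<close> of the
time after \<open>t\<close>; for \<open>A\<close> in \<open>\<F>\<^sub>t\<close> this is \<open>nn_integral_occupation_density\<close>.\<close>

definition occupation_density :: "(real \<Rightarrow> path measure) \<Rightarrow> (real \<Rightarrow> real) \<Rightarrow> real \<Rightarrow> real \<Rightarrow> path set \<Rightarrow> real \<Rightarrow> ennreal" where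
  "occupation_density P u x t A y = (\<integral>\<^sup>+\<omega>. indicator A \<omega> * potential_density u (y - X t \<omega>) \<partial>P x)"

lemma measurable_occupation_density_integrand:
  assumes sub: "subordinator \<kappa> \<nu> P" and u: "continuous_potential_density P u"
    and t: "0 \<le> t" and A: "A \<in> sets path_space"
  shows "(\<lambda>(y, \<omega>). indicator A \<omega> * potential_density u (y - X t \<omega>)) \<in> borel_measurable (lborel \<Otimes>\<^sub>M P x)"
proof -
  have Xt: "X t \<in> borel_measurable (P x)" unfolding measurable_P[OF sub] using t by (rule measurable_X)
  have A': "indicator A \<in> borel_measurable (P x)"
    using A subordinator_space[OF sub] by (intro borel_measurable_indicator) simp
  show ?thesis
    unfolding case_prod_beta
    by (intro borel_measurable_times_ennreal measurable_compose[OF measurable_snd A']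
       measurable_compose[OF _ measurable_potential_density[OF u]] borel_measurable_diff
       measurable_compose[OF measurable_snd Xt] measurable_compose[OF measurable_fst]) auto
qed

lemma measurable_occupation_density:
  assumes sub: "subordinator \<kappa> \<nu> P" and u: "continuous_potential_density P u"
    and t: "0 \<le> t" and A: "A \<in> sets path_space"
  shows "occupation_density P u x t A \<in> borel_measurable borel"
proof -
  interpret prob_space "P x" using sub by (rule prob_space_P)
  show ?thesis
    using borel_measurable_nn_integral[OF measurable_occupation_density_integrand[OF assms, of x]]
    by (simp add: occupation_density_def[abs_def])
qed

text \<open>The occupation formula, with the potential measure replaced by its density and the order of
integration exchanged.\<close>

lemma nn_integral_occupation_density:
  assumes sub: "subordinator \<kappa> \<nu> P" and u: "continuous_potential_density P u"
    and t: "0 \<le> t" and A: "A \<in> sets (filt t)" and g: "g \<in> borel_measurable borel"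
  shows "(\<integral>\<^sup>+y. g y * occupation_density P u x t A y \<partial>lborel)
     = (\<integral>\<^sup>+\<omega>. indicator A \<omega> * (\<integral>\<^sup>+s\<in>{t..}. g (X s \<omega>) \<partial>lborel) \<partial>P x)"
proof -
  interpret Px: prob_space "P x" using sub by (rule prob_space_P)
  interpret pair_sigma_finite lborel "P x" by unfold_locales
  have A': "A \<in> sets path_space" using A sets_filt_path_space by auto
  note m = measurable_occupation_density_integrand[OF sub u t A', of x]
  have m1: "(\<lambda>\<omega>. indicator A \<omega> * potential_density u (y - X t \<omega>)) \<in> borel_measurable (P x)" for y
    using measurable_compose[OF measurable_Pair1' m, of y] by simp
  have "(\<integral>\<^sup>+y. g y * occupation_density P u x t A y \<partial>lborel)
     = (\<integral>\<^sup>+y. \<integral>\<^sup>+\<omega>. g y * (indicator A \<omega> * potential_density u (y - X t \<omega>)) \<partial>P x \<partial>lborel)"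
    unfolding occupation_density_def by (intro nn_integral_cong nn_integral_cmult[symmetric] m1)
  also have "\<dots> = (\<integral>\<^sup>+\<omega>. \<integral>\<^sup>+y. g y * (indicator A \<omega> * potential_density u (y - X t \<omega>)) \<partial>lborel \<partial>P x)"
  proof (rule Fubini'[symmetric])
    have "(\<lambda>z. g (fst z)) \<in> borel_measurable (lborel \<Otimes>\<^sub>M P x)"
      using g by (intro measurable_compose[OF measurable_fst]) simp
    from borel_measurable_times_ennreal[OF this m]
    show "(\<lambda>(y, \<omega>). g y * (indicator A \<omega> * potential_density u (y - X t \<omega>))) \<in> borel_measurable (lborel \<Otimes>\<^sub>M P x)"
      by (simp add: case_prod_beta)
  qed
  also have "\<dots> = (\<integral>\<^sup>+\<omega>. indicator A \<omega> * (\<integral>\<^sup>+w. g (X t \<omega> + w) \<partial>potential P) \<partial>P x)"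
  proof (rule nn_integral_cong)
    fix \<omega>
    have "(\<lambda>y. g y * potential_density u (y - X t \<omega>)) \<in> borel_measurable lborel"
    proof (rule borel_measurable_times_ennreal)
      show "g \<in> borel_measurable lborel" using g by simp
      show "(\<lambda>y. potential_density u (y - X t \<omega>)) \<in> borel_measurable lborel"
        by (rule measurable_compose[OF _ measurable_potential_density[OF u]]) simp
    qed
    from nn_integral_cmult[OF this, of "indicator A \<omega>"]
    show "(\<integral>\<^sup>+y. g y * (indicator A \<omega> * potential_density u (y - X t \<omega>)) \<partial>lborel)
      = indicator A \<omega> * (\<integral>\<^sup>+w. g (X t \<omega> + w) \<partial>potential P)"
      unfolding nn_integral_potential_shift[OF u g] by (simp add: mult_ac)
  qed
  also have "\<dots> = (\<integral>\<^sup>+\<omega>. indicator A \<omega> * (\<integral>\<^sup>+s\<in>{t..}. g (X s \<omega>) \<partial>lborel) \<partial>P x)"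
    using A by (intro occupation_formula[OF sub t _ g, symmetric]) simp
  finally show ?thesis .
qed

lemma occupation_density_0:
  assumes sub: "subordinator \<kappa> \<nu> P"
  shows "occupation_density P u x 0 paths y = potential_density u (y - x)"
proof -
  interpret prob_space "P x" using sub by (rule prob_space_P)
  have "occupation_density P u x 0 paths y = (\<integral>\<^sup>+\<omega>. potential_density u (y - x) \<partial>P x)"
    unfolding occupation_density_def
  proof (rule nn_integral_cong_AE)
    show "AE \<omega> in P x. indicator paths \<omega> * potential_density u (y - X 0 \<omega>) = potential_density u (y - x)"
      using AE_P[OF sub, of x] AE_space by eventually_elim (simp add: subordinator_space[OF sub])
  qed
  then show ?thesis by (simp add: emeasure_space_1)
qed

text \<open>The potential measure is excessive: the time spent in a set after \<open>t\<close> is at most the time spent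
there after \<open>0\<close>. Applied to the zero set of \<open>y \<mapsto> u(y - x)\<close>, where the latter has mean zero, this
says that the density of the former vanishes almost everywhere on that set.\<close>

lemma occupation_density_null:
  assumes sub: "subordinator \<kappa> \<nu> P" and u: "continuous_potential_density P u"
    and t: "0 \<le> t" and A: "A \<in> sets (filt t)"
  shows "AE y in lborel. potential_density u (y - x) = 0 \<longrightarrow> occupation_density P u x t A y = 0"
proof -
  define N where "N = {y. potential_density u (y - x) = 0}"
  have "(\<lambda>y. potential_density u (y - x)) \<in> borel_measurable borel"
    using measurable_potential_density[OF u] by (rule measurable_compose[rotated]) simp
  from measurable_sets[OF this, of "{0}"] have N: "N \<in> sets borel"
    by (simp add: N_def vimage_def)
  have A': "A \<in> sets path_space" using A sets_filt_path_space by auto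
  have "(\<integral>\<^sup>+y. indicator N y * occupation_density P u x t A y \<partial>lborel)
     = (\<integral>\<^sup>+\<omega>. indicator A \<omega> * (\<integral>\<^sup>+s\<in>{t..}. indicator N (X s \<omega>) \<partial>lborel) \<partial>P x)"
    using N by (intro nn_integral_occupation_density[OF sub u t A]) simp
  also have "\<dots> \<le> (\<integral>\<^sup>+\<omega>. indicator paths \<omega> * (\<integral>\<^sup>+s\<in>{0..}. indicator N (X s \<omega>) \<partial>lborel) \<partial>P x)"
    using t by (intro nn_integral_mono mult_mono)
      (auto simp: subordinator_space[OF sub] indicator_def intro!: nn_integral_mono)
  also have "\<dots> = (\<integral>\<^sup>+y. indicator N y * occupation_density P u x 0 paths y \<partial>lborel)"
    using N by (intro nn_integral_occupation_density[OF sub u, symmetric]) simp_all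
  also have "\<dots> = (\<integral>\<^sup>+y. 0 \<partial>(lborel :: real measure))"
    by (intro nn_integral_cong) (simp add: occupation_density_0[OF sub] N_def indicator_def)
  finally have "(\<integral>\<^sup>+y. indicator N y * occupation_density P u x t A y \<partial>lborel) = 0" by simp
  moreover have "(\<lambda>y. indicator N y * occupation_density P u x t A y) \<in> borel_measurable lborel"
    using N measurable_occupation_density[OF sub u t A', of x] by (intro borel_measurable_times_ennreal) auto
  ultimately have "AE y in lborel. indicator N y * occupation_density P u x t A y = 0"
    by (simp add: nn_integral_0_iff_AE)
  then show ?thesis by eventually_elim (auto simp: N_def indicator_def split: if_splits)
qed

text \<open>If \<open>u(y - x) = 0\<close>, the quotient of reals in the definition of \<open>circ_law\<close> is \<open>0\<close>, whereas a
quotient by \<open>0\<close> in \<open>ennreal\<close> may be \<open>\<infinity>\<close>; hence the case distinction.\<close>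

lemma circ_law_occupation_density:
  assumes sub: "subordinator \<kappa> \<nu> P" and u: "continuous_potential_density P u" and "x < y"
    and circ: "circ_law P u y x M" and t: "0 \<le> t" and A: "A \<in> sets (filt t)"
  shows "emeasure M {\<omega> \<in> A. ereal t < lifetime \<omega>} =
    (if potential_density u (y - x) = 0 then 0
     else occupation_density P u x t A y / potential_density u (y - x))"
proof -
  have u0: "0 \<le> u z" if "0 < z" for z
    using u that unfolding continuous_potential_density_def by blast
  have v: "potential_density u (y - x) = ennreal (u (y - x))" using \<open>x < y\<close> by (simp add: potential_density_def)
  have Ap: "A \<subseteq> paths" using sets.sets_into_space[OF A] by simp
  have A': "A \<in> sets path_space" using A sets_filt_path_space by auto
  have "emeasure M {\<omega> \<in> A. ereal t < lifetime \<omega>}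
    = (\<integral>\<^sup>+\<omega>\<in>{\<omega> \<in> A. X t \<omega> < y}. ennreal (u (y - X t \<omega>) / u (y - x)) \<partial>P x)"
    using circ t A unfolding circ_law_def by blast
  also have "\<dots> = (if potential_density u (y - x) = 0 then 0
     else occupation_density P u x t A y / potential_density u (y - x))"
  proof (cases "u (y - x) = 0")
    case True
    then show ?thesis by (simp add: v)
  next
    case False
    then have pos: "0 < u (y - x)" using u0[of "y - x"] \<open>x < y\<close> by simp
    have "(\<lambda>\<omega>. indicator A \<omega> * potential_density u (y - X t \<omega>)) \<in> borel_measurable (P x)"
      using measurable_compose[OF measurable_Pair1' measurable_occupation_density_integrand[OF sub u t A', of x], of y] by simp
    from nn_integral_divide[OF this, of "ennreal (u (y - x))"]
    have "occupation_density P u x t A y / ennreal (u (y - x))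
      = (\<integral>\<^sup>+\<omega>. indicator A \<omega> * potential_density u (y - X t \<omega>) / ennreal (u (y - x)) \<partial>P x)"
      by (simp add: occupation_density_def)
    also have "\<dots> = (\<integral>\<^sup>+\<omega>\<in>{\<omega> \<in> A. X t \<omega> < y}. ennreal (u (y - X t \<omega>) / u (y - x)) \<partial>P x)"
      using u0 pos by (intro nn_integral_cong)
        (auto simp: potential_density_def indicator_def divide_ennreal)
    finally show ?thesis using pos by (simp add: v)
  qed
  finally show ?thesis .
qed

section \<open>Conditional laws from a generator\<close>

text \<open>For fixed \<open>B\<close> both sides are finite measures in the event, so the class of events on which they
agree is closed under complements and countable disjoint unions. The whole space, where both sides
are the law of \<open>Z\<close> at \<open>B\<close>, is covered by the empty event and its complement.\<close>

lemma conditional_law_on_generatorI: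
  assumes M: "prob_space M" and Z: "Z \<in> M \<rightarrow>\<^sub>M N" and S: "S \<in> sets N"
    and K: "K \<in> restrict_space N S \<rightarrow>\<^sub>M prob_algebra M"
    and G: "sets M = sigma_sets (space M) G" "Int_stable G" "G \<subseteq> Pow (space M)"
    and eq: "\<And>E B. E \<in> G \<Longrightarrow> B \<in> sets N \<Longrightarrow> B \<subseteq> S \<Longrightarrow>
      emeasure M (E \<inter> Z -` B) = (\<integral>\<^sup>+z\<in>B. emeasure (K z) E \<partial>distr M N Z)"
  shows "conditional_law_on M Z N S K"
  unfolding conditional_law_on_def
proof (intro conjI ballI impI)
  fix A B assume A: "A \<in> sets M" and B: "B \<in> sets N" "B \<subseteq> S"
  interpret prob_space M by fact
  interpret N: prob_space "distr M N Z" using Z by (rule prob_space_distr)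
  have SN: "S \<subseteq> space N" using sets.sets_into_space[OF S] .
  have Kz: "prob_space (K z)" "sets (K z) = sets M" "space (K z) = space M" if "z \<in> B" for z
  proof -
    have "z \<in> space (restrict_space N S)" using that B SN by (auto simp: space_restrict_space)
    from measurable_space[OF K this] show "prob_space (K z)" "sets (K z) = sets M"
      by (simp_all add: space_prob_algebra)
    then show "space (K z) = space M" by (intro sets_eq_imp_space_eq)
  qed
  have mK: "(\<lambda>z. emeasure (K z) A * indicator B z) \<in> borel_measurable (distr M N Z)" if "A \<in> sets M" for A
  proof -
    have "(\<lambda>z. emeasure (K z) A) \<in> borel_measurable (restrict_space N S)"
      using measurable_compose[OF measurable_prob_algebraD[OF K] measurable_emeasure_subprob_algebra[OF that]] .
    then have 1: "(\<lambda>z. emeasure (K z) A * indicator S z) \<in> borel_measurable N"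
      using S by (subst (asm) borel_measurable_restrict_space_iff_ennreal) auto
    have "indicator B \<in> borel_measurable N" using B(1) by (rule borel_measurable_indicator)
    with 1 have "(\<lambda>z. emeasure (K z) A * indicator S z * indicator B z) \<in> borel_measurable N"
      by (rule borel_measurable_times_ennreal)
    moreover have "emeasure (K z) A * indicator S z * indicator B z = emeasure (K z) A * indicator B z" for z
      using B by (auto simp: indicator_def)
    ultimately show ?thesis by simp
  qed
  have ZB: "Z -` B \<inter> space M \<in> sets M" using Z B by (intro measurable_sets)
  have AZ: "A \<inter> Z -` B = A \<inter> (Z -` B \<inter> space M)" if "A \<in> sets M" for A
    using sets.sets_into_space[OF that] by auto
  have AZ': "A \<inter> Z -` B \<in> sets M" if "A \<in> sets M" for A
    unfolding AZ[OF that] using that ZB by auto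
  from A have "A \<in> sigma_sets (space M) G" using G(1) by simp
  with G(2,3) show "emeasure M (A \<inter> Z -` B) = (\<integral>\<^sup>+z\<in>B. emeasure (K z) A \<partial>distr M N Z)"
  proof (induction rule: sigma_sets_induct_disjoint)
    case (basic E)
    then show ?case using eq B by blast
  next
    case empty
    show ?case by simp
  next
    case (compl A)
    then have A: "A \<in> sets M" using G(1) by simp
    have "(space M - A) \<inter> Z -` B = (Z -` B \<inter> space M) - (A \<inter> Z -` B)" by auto
    then have "emeasure M ((space M - A) \<inter> Z -` B) = emeasure M (Z -` B \<inter> space M) - emeasure M (A \<inter> Z -` B)"
      using emeasure_Diff[OF _ ZB AZ'[OF A]] sets.sets_into_space[OF A] by (simp add: emeasure_eq_measure) blast
    also have "emeasure M (Z -` B \<inter> space M) = (\<integral>\<^sup>+z. indicator B z \<partial>distr M N Z)"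
      using Z B by (simp add: emeasure_distr)
    also have "\<dots> - emeasure M (A \<inter> Z -` B)
        = (\<integral>\<^sup>+z. indicator B z - emeasure (K z) A * indicator B z \<partial>distr M N Z)"
      unfolding compl.IH
    proof (rule nn_integral_diff[symmetric])
      show "indicator B \<in> borel_measurable (distr M N Z)" using B by simp
      show "(\<lambda>z. emeasure (K z) A * indicator B z) \<in> borel_measurable (distr M N Z)" using A by (rule mK)
      show "(\<integral>\<^sup>+z\<in>B. emeasure (K z) A \<partial>distr M N Z) \<noteq> \<infinity>"
        unfolding compl.IH[symmetric] by (simp add: emeasure_eq_measure)
      show "AE z in distr M N Z. emeasure (K z) A * indicator B z \<le> indicator B z"
        using Kz by (intro AE_I2) (auto simp: indicator_def prob_space.emeasure_le_1)
    qed
    also have "\<dots> = (\<integral>\<^sup>+z\<in>B. emeasure (K z) (space M - A) \<partial>distr M N Z)"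
    proof (rule nn_integral_cong)
      fix z
      show "indicator B z - emeasure (K z) A * indicator B z = emeasure (K z) (space M - A) * indicator B z"
      proof (cases "z \<in> B")
        case True
        interpret Kz: prob_space "K z" using Kz(1)[OF True] .
        have "emeasure (K z) (space (K z) - A) = 1 - emeasure (K z) A"
          using A Kz(2)[OF True] by (simp add: emeasure_compl Kz.emeasure_space_1)
        then show ?thesis using True Kz[OF True] by simp
      qed simp
    qed
    finally show ?case .
  next
    case (union F)
    then have F: "F i \<in> sets M" for i using G(1) by auto
    have "emeasure M (\<Union> (range F) \<inter> Z -` B) = emeasure M (\<Union>i. F i \<inter> Z -` B)"
      by (intro arg_cong[where f = "emeasure M"]) auto
    also have "\<dots> = (\<Sum>i. emeasure M (F i \<inter> Z -` B))"
      using union(1) AZ'[OF F] by (intro suminf_emeasure[symmetric]) (auto simp: disjoint_family_on_def)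
    also have "\<dots> = (\<Sum>i. \<integral>\<^sup>+z\<in>B. emeasure (K z) (F i) \<partial>distr M N Z)"
      using union(3) by simp
    also have "\<dots> = (\<integral>\<^sup>+z. (\<Sum>i. emeasure (K z) (F i) * indicator B z) \<partial>distr M N Z)"
      by (intro nn_integral_suminf[symmetric] mK F)
    also have "\<dots> = (\<integral>\<^sup>+z\<in>B. emeasure (K z) (\<Union> (range F)) \<partial>distr M N Z)"
    proof (rule nn_integral_cong)
      fix z
      show "(\<Sum>i. emeasure (K z) (F i) * indicator B z) = emeasure (K z) (\<Union> (range F)) * indicator B z"
      proof (cases "z \<in> B")
        case True
        then show ?thesis using suminf_emeasure[of F "K z"] union(1) F Kz[OF True] by auto
      qed simp
    qed
    finally show ?case .
  qed
qed fact+

section \<open>The subordinator killed at a random time\<close>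

text \<open>The mass of the pairs \<open>(\<omega>, s)\<close> for which \<open>X\<^sub>s(\<omega>) < a\<close> and the path killed at \<open>s\<close> lies in \<open>S\<close>.
It is not normalised: its total mass is \<open>U(a - x)\<close> for \<open>x < a\<close>.\<close>

definition killed_mass :: "(real \<Rightarrow> path measure) \<Rightarrow> real \<Rightarrow> real \<Rightarrow> path set \<Rightarrow> ennreal" where
  "killed_mass P a x S = (\<integral>\<^sup>+\<omega>. \<integral>\<^sup>+s. indicator {0..} s * indicator {..<a} (X (max 0 s) \<omega>) *
     indicator S (kill_path s \<omega>) \<partial>lborel \<partial>P x)"

lemma measurable_kill_weight:
  "(\<lambda>(\<omega>, s). indicator {0..} s * indicator {..<a} (X (max 0 s) \<omega>) :: ennreal)
     \<in> borel_measurable (path_space \<Otimes>\<^sub>M lborel)"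
proof -
  have eq: "path_space \<Otimes>\<^sub>M lborel \<rightarrow>\<^sub>M borel = path_space \<Otimes>\<^sub>M borel \<rightarrow>\<^sub>M (borel :: ennreal measure)"
    by (intro measurable_cong_sets sets_pair_measure_cong) simp_all
  have "(\<lambda>z. indicator {..<a} (case z of (\<omega>, s) \<Rightarrow> X (max 0 s) \<omega>) :: ennreal) \<in> borel_measurable (path_space \<Otimes>\<^sub>M borel)"
    by (rule measurable_compose[OF measurable_X_pair]) simp
  then show ?thesis
    unfolding eq case_prod_beta by (intro borel_measurable_times_ennreal measurable_compose[OF measurable_snd]) auto
qed

lemma measurable_kill_integrand:
  assumes S: "S \<in> sets path_space"
  shows "(\<lambda>(\<omega>, s). indicator {0..} s * indicator {..<a} (X (max 0 s) \<omega>) *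
     indicator S (kill_path s \<omega>) :: ennreal) \<in> borel_measurable (path_space \<Otimes>\<^sub>M lborel)"
proof -
  have eq: "path_space \<Otimes>\<^sub>M lborel \<rightarrow>\<^sub>M borel = path_space \<Otimes>\<^sub>M borel \<rightarrow>\<^sub>M (borel :: ennreal measure)"
    by (intro measurable_cong_sets sets_pair_measure_cong) simp_all
  have "(\<lambda>z. indicator S (case z of (\<omega>, s) \<Rightarrow> kill_path s \<omega>) :: ennreal) \<in> borel_measurable (path_space \<Otimes>\<^sub>M borel)"
    using S by (intro measurable_compose[OF measurable_kill_path] borel_measurable_indicator)
  with measurable_kill_weight[of a] show ?thesis
    unfolding eq case_prod_beta by (rule borel_measurable_times_ennreal)
qed

lemma sets_alive_left_limit:
  assumes t: "0 \<le> t" and A: "A \<in> sets (filt t)" and B: "B \<in> sets cemetery_borel"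
  shows "{\<omega> \<in> A. ereal t < lifetime \<omega>} \<inter> X_lifetime_left -` B \<in> sets path_space"
proof -
  have E: "{\<omega> \<in> A. ereal t < lifetime \<omega>} \<in> sets path_space"
    using sets_filt_lifetime[OF t A] sets_filt_path_space by auto
  have "{\<omega> \<in> A. ereal t < lifetime \<omega>} \<inter> X_lifetime_left -` B
     = {\<omega> \<in> A. ereal t < lifetime \<omega>} \<inter> (X_lifetime_left -` B \<inter> space path_space)"
    using sets.sets_into_space[OF E] by auto
  also have "\<dots> \<in> sets path_space"
    using E measurable_sets[OF measurable_X_lifetime_left B] by (rule sets.Int)
  finally show ?thesis .
qed

text \<open>The killed path is alive at \<open>t\<close> when the killing time is later than \<open>t\<close>; it then agrees with the
original path up to time \<open>t\<close>, and almost always its left limit at the lifetime is \<open>X\<^sub>s\<close>.\<close>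

lemma kill_integral_alive:
  assumes good: "\<omega> \<in> paths" "lifetime \<omega> = \<infinity>" "\<And>s t. 0 \<le> s \<Longrightarrow> s \<le> t \<Longrightarrow> X s \<omega> \<le> X t \<omega>"
    and t: "0 \<le> t" and A: "A \<in> sets (filt t)"
  shows "(\<integral>\<^sup>+s. indicator {0..} s * indicator {..<a} (X (max 0 s) \<omega>) *
       indicator ({\<omega> \<in> A. ereal t < lifetime \<omega>} \<inter> X_lifetime_left -` B) (kill_path s \<omega>) \<partial>lborel)
    = (\<integral>\<^sup>+s. indicator A \<omega> * (indicator ({..<a} \<inter> Some -` B) (X s \<omega>) * indicator {t..} s) \<partial>lborel)"
proof (rule nn_integral_cong_AE)
  have "AE s in lborel. 0 < s \<longrightarrow> X_lifetime_left (kill_path s \<omega>) = Some (X s \<omega>)"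
    using good by (rule X_lifetime_left_kill_path_AE)
  then show "AE s in lborel. indicator {0..} s * indicator {..<a} (X (max 0 s) \<omega>) *
       indicator ({\<omega> \<in> A. ereal t < lifetime \<omega>} \<inter> X_lifetime_left -` B) (kill_path s \<omega>)
    = (indicator A \<omega> * (indicator ({..<a} \<inter> Some -` B) (X s \<omega>) * indicator {t..} s) :: ennreal)"
    using AE_lborel_singleton[of t]
  proof eventually_elim
    case (elim s)
    have life: "ereal t < lifetime (kill_path s \<omega>) \<longleftrightarrow> t < s"
      using less_lifetime_kill_path[OF good(1) t, of s] good(2) by simp
    show ?case
    proof (cases "t < s")
      case True
      have "kill_path s \<omega> \<in> A \<longleftrightarrow> \<omega> \<in> A"
        using True by (intro filt_determined[OF A kill_path_in_paths[OF good(1)] good(1)])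
          (simp add: kill_path_def)
      moreover have "X_lifetime_left (kill_path s \<omega>) = Some (X s \<omega>)" using elim(1) True t by simp
      ultimately show ?thesis using True t life by (auto simp: indicator_def)
    next
      case False
      then show ?thesis using elim(2) life by (auto simp: indicator_def)
    qed
  qed
qed

text \<open>For a law given by killing, the joint law of the past and of the position at death is the
occupation measure after \<open>t\<close>.\<close>

lemma killed_mass_alive:
  assumes sub: "subordinator \<kappa> \<nu> P" and u: "continuous_potential_density P u"
    and t: "0 \<le> t" and A: "A \<in> sets (filt t)" and B: "B \<in> sets cemetery_borel"
  shows "killed_mass P a x ({\<omega> \<in> A. ereal t < lifetime \<omega>} \<inter> X_lifetime_left -` B)
    = (\<integral>\<^sup>+y. indicator ({..<a} \<inter> Some -` B) y * occupation_density P u x t A y \<partial>lborel)"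
proof -
  let ?D = "{..<a} \<inter> Some -` B"
  let ?S = "{\<omega> \<in> A. ereal t < lifetime \<omega>} \<inter> X_lifetime_left -` B"
  have A': "A \<in> sets path_space" using A sets_filt_path_space by auto
  have D: "?D \<in> sets borel" using B by (auto simp: sets_cemetery_borel)
  have S: "?S \<in> sets path_space" using t A B by (rule sets_alive_left_limit)
  have m1: "(\<lambda>\<omega>. \<integral>\<^sup>+s. indicator {0..} s * indicator {..<a} (X (max 0 s) \<omega>) * indicator ?S (kill_path s \<omega>) \<partial>lborel)
      \<in> borel_measurable path_space"
    using lborel.borel_measurable_nn_integral[OF measurable_kill_integrand[OF S, of a]] .
  have eq: "(\<integral>\<^sup>+s. indicator A \<omega> * (indicator ?D (X s \<omega>) * indicator {t..} s) \<partial>lborel)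
      = indicator A \<omega> * (\<integral>\<^sup>+s\<in>{t..}. indicator ?D (X s \<omega>) \<partial>lborel)" for \<omega>
    by (cases "\<omega> \<in> A") simp_all
  have "(\<lambda>z. indicator ?D (case z of (\<omega>, s) \<Rightarrow> X (max 0 s) \<omega>) :: ennreal) \<in> borel_measurable (path_space \<Otimes>\<^sub>M borel)"
    using D by (intro measurable_compose[OF measurable_X_pair]) simp
  then have "(\<lambda>(\<omega>, s). indicator ?D (X (max 0 s) \<omega>) * indicator {t..} s :: ennreal) \<in> borel_measurable (path_space \<Otimes>\<^sub>M borel)"
    unfolding case_prod_beta by (intro borel_measurable_times_ennreal measurable_compose[OF measurable_snd]) auto
  also have "path_space \<Otimes>\<^sub>M borel \<rightarrow>\<^sub>M borel = path_space \<Otimes>\<^sub>M lborel \<rightarrow>\<^sub>M (borel :: ennreal measure)"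
    by (intro measurable_cong_sets sets_pair_measure_cong) simp_all
  finally have "(\<lambda>\<omega>. \<integral>\<^sup>+s. indicator ?D (X (max 0 s) \<omega>) * indicator {t..} s \<partial>lborel) \<in> borel_measurable path_space"
    by (rule lborel.borel_measurable_nn_integral)
  also have "(\<lambda>\<omega>. \<integral>\<^sup>+s. indicator ?D (X (max 0 s) \<omega>) * indicator {t..} s \<partial>lborel)
     = (\<lambda>\<omega>. \<integral>\<^sup>+s\<in>{t..}. indicator ?D (X s \<omega>) \<partial>lborel)"
    using t by (intro ext nn_integral_cong) (simp add: indicator_def)
  finally have "(\<lambda>\<omega>. indicator A \<omega> * (\<integral>\<^sup>+s\<in>{t..}. indicator ?D (X s \<omega>) \<partial>lborel)) \<in> borel_measurable path_space"
    using A' by (intro borel_measurable_times_ennreal) auto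
  then have m2: "(\<lambda>\<omega>. \<integral>\<^sup>+s. indicator A \<omega> * (indicator ?D (X s \<omega>) * indicator {t..} s) \<partial>lborel) \<in> borel_measurable path_space"
    unfolding eq .
  have "killed_mass P a x ?S
     = (\<integral>\<^sup>+\<omega>. \<integral>\<^sup>+s. indicator A \<omega> * (indicator ?D (X s \<omega>) * indicator {t..} s) \<partial>lborel \<partial>P x)"
    unfolding killed_mass_def
    by (rule nn_integral_P_cong[OF sub m1 m2]) (rule kill_integral_alive[OF _ _ _ t A])
  also have "\<dots> = (\<integral>\<^sup>+y. indicator ?D y * occupation_density P u x t A y \<partial>lborel)"
    unfolding eq using D by (intro nn_integral_occupation_density[OF sub u t A, symmetric]) simp
  finally show ?thesis .
qed

text \<open>By the occupation formula, \<open>E\<^sub>x[\<one>\<^sub>A U(a - X\<^sub>t) \<one>{X\<^sub>t < a}]\<close> is the mean time spent below \<open>a\<close>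
after \<open>t\<close> on the event \<open>A\<close>.\<close>

lemma down_law_alive:
  assumes sub: "subordinator \<kappa> \<nu> P" and u: "continuous_potential_density P u"
    and down: "down_law P a x M" and t: "0 \<le> t" and A: "A \<in> sets (filt t)"
  shows "emeasure M {\<omega> \<in> A. ereal t < lifetime \<omega>}
    = (\<integral>\<^sup>+y. indicator {..<a} y * occupation_density P u x t A y \<partial>lborel) / renewal P (a - x)"
proof -
  have Xt: "X t \<in> borel_measurable (P x)" unfolding measurable_P[OF sub] using t by (rule measurable_X)
  have A': "A \<in> sets (P x)" using A sets_filt_path_space subordinator_space(2)[OF sub] by auto
  have m: "(\<lambda>\<omega>. indicator A \<omega> * (renewal P (a - X t \<omega>) * indicator {..<a} (X t \<omega>))) \<in> borel_measurable (P x)"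
  proof (rule borel_measurable_times_ennreal)
    have "(\<lambda>r. \<integral>\<^sup>+y. indicator {..<a} y * potential_density u (y - r) \<partial>lborel) \<in> borel_measurable borel"
    proof (rule lborel.borel_measurable_nn_integral)
      show "(\<lambda>(r, y). indicator {..<a} y * potential_density u (y - r)) \<in> borel_measurable (borel \<Otimes>\<^sub>M lborel)"
        unfolding case_prod_beta
        by (intro borel_measurable_times_ennreal measurable_compose[OF _ measurable_potential_density[OF u]]
           measurable_compose[OF measurable_snd] borel_measurable_diff measurable_compose[OF measurable_fst]) auto
    qed
    also have "(\<lambda>r. \<integral>\<^sup>+y. indicator {..<a} y * potential_density u (y - r) \<partial>lborel)
       = (\<lambda>r. renewal P (a - r) * indicator {..<a} r)"
      unfolding renewal_eq_potential[OF sub u]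
      by (intro ext nn_integral_potential_shift[OF u, symmetric]) simp
    finally show "(\<lambda>\<omega>. renewal P (a - X t \<omega>) * indicator {..<a} (X t \<omega>)) \<in> borel_measurable (P x)"
      by (rule measurable_compose[OF Xt])
  qed (use A' in simp)
  have "emeasure M {\<omega> \<in> A. ereal t < lifetime \<omega>}
     = (\<integral>\<^sup>+\<omega>\<in>{\<omega> \<in> A. X t \<omega> < a}. renewal P (a - X t \<omega>) / renewal P (a - x) \<partial>P x)"
    using down t A unfolding down_law_def by blast
  also have "\<dots> = (\<integral>\<^sup>+\<omega>. indicator A \<omega> * (renewal P (a - X t \<omega>) * indicator {..<a} (X t \<omega>)) / renewal P (a - x) \<partial>P x)"
    by (intro nn_integral_cong) (auto simp: indicator_def)
  also have "\<dots> = (\<integral>\<^sup>+\<omega>. indicator A \<omega> * (renewal P (a - X t \<omega>) * indicator {..<a} (X t \<omega>)) \<partial>P x) / renewal P (a - x)"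
    using m by (rule nn_integral_divide)
  also have "(\<integral>\<^sup>+\<omega>. indicator A \<omega> * (renewal P (a - X t \<omega>) * indicator {..<a} (X t \<omega>)) \<partial>P x)
     = (\<integral>\<^sup>+y. indicator {..<a} y * occupation_density P u x t A y \<partial>lborel)"
  proof -
    have "(\<integral>\<^sup>+y. indicator {..<a} y * occupation_density P u x t A y \<partial>lborel)
       = (\<integral>\<^sup>+\<omega>. indicator A \<omega> * (\<integral>\<^sup>+s\<in>{t..}. indicator {..<a} (X s \<omega>) \<partial>lborel) \<partial>P x)"
      by (intro nn_integral_occupation_density[OF sub u t A]) simp
    also have "\<dots> = (\<integral>\<^sup>+\<omega>. indicator A \<omega> * (\<integral>\<^sup>+w. indicator {..<a} (X t \<omega> + w) \<partial>potential P) \<partial>P x)"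
      using A by (intro occupation_formula[OF sub t]) simp_all
    finally show ?thesis unfolding renewal_eq_potential[OF sub u] by simp
  qed
  finally show ?thesis .
qed

lemma nn_integral_occupation_density_0:
  assumes sub: "subordinator \<kappa> \<nu> P" and u: "continuous_potential_density P u" and "x < a"
  shows "(\<integral>\<^sup>+y. indicator {..<a} y * occupation_density P u x 0 paths y \<partial>lborel) = renewal P (a - x)"
proof -
  have "renewal P (a - x) = (\<integral>\<^sup>+w. indicator {..<a} (x + w) \<partial>potential P)"
    using renewal_eq_potential[OF sub u, of a x] \<open>x < a\<close> by simp
  also have "\<dots> = (\<integral>\<^sup>+y. indicator {..<a} y * potential_density u (y - x) \<partial>lborel)"
    using u by (rule nn_integral_potential_shift) simp
  finally show ?thesis by (simp add: occupation_density_0[OF sub])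
qed

text \<open>At time \<open>0\<close> the prescribed mass is \<open>U(a - x) / U(a - x)\<close>, which in \<open>ennreal\<close> is \<open>0\<close> when
\<open>U(a - x)\<close> is \<open>0\<close> or \<open>\<infinity>\<close>.\<close>

lemma down_law_degenerate:
  assumes sub: "subordinator \<kappa> \<nu> P" and u: "continuous_potential_density P u" and "x < a"
    and down: "down_law P a x M" and deg: "renewal P (a - x) = 0 \<or> renewal P (a - x) = \<infinity>"
  shows "emeasure M {\<omega> \<in> paths. 0 < lifetime \<omega>} = 0"
  using down_law_alive[OF sub u down order_refl, of paths] nn_integral_occupation_density_0[OF sub u \<open>x < a\<close>] deg
  by (auto simp: zero_ereal_def)

text \<open>The law of the killed path and \<open>M\<close> have the same mass on the events before the lifetime, by
\<open>killed_mass_alive\<close> and \<open>down_law_alive\<close>.\<close>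

lemma down_law_eq_killed:
  assumes sub: "subordinator \<kappa> \<nu> P" and u: "continuous_potential_density P u" and "x < a"
    and down: "down_law P a x M" and c: "renewal P (a - x) \<noteq> 0" "renewal P (a - x) \<noteq> \<infinity>"
    and S: "S \<in> sets path_space"
  shows "emeasure M S = killed_mass P a x S / renewal P (a - x)"
proof -
  interpret Px: prob_space "P x" using sub by (rule prob_space_P)
  define c where "c = renewal P (a - x)"
  define w :: "path \<times> real \<Rightarrow> ennreal" where "w = (\<lambda>(\<omega>, s). indicator {0..} s * indicator {..<a} (X (max 0 s) \<omega>))"
  define Q where "Q = distr (density (P x \<Otimes>\<^sub>M lborel) (\<lambda>z. w z / c)) path_space (\<lambda>(\<omega>, s). kill_path s \<omega>)"
  have cong: "P x \<Otimes>\<^sub>M lborel \<rightarrow>\<^sub>M N = path_space \<Otimes>\<^sub>M lborel \<rightarrow>\<^sub>M N" for N :: "'z measure"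
    by (intro measurable_cong_sets sets_pair_measure_cong) (simp_all add: subordinator_space[OF sub])
  have cong': "path_space \<Otimes>\<^sub>M lborel \<rightarrow>\<^sub>M N = path_space \<Otimes>\<^sub>M borel \<rightarrow>\<^sub>M N" for N :: "'z measure"
    by (intro measurable_cong_sets sets_pair_measure_cong) simp_all
  have w: "(\<lambda>z. w z / c) \<in> borel_measurable (P x \<Otimes>\<^sub>M lborel)"
    unfolding cong w_def using measurable_kill_weight[of a] by simp
  have kill: "(\<lambda>(\<omega>, s). kill_path s \<omega>) \<in> P x \<Otimes>\<^sub>M lborel \<rightarrow>\<^sub>M path_space"
    unfolding cong cong' by (rule measurable_kill_path)
  have Q: "emeasure Q S = killed_mass P a x S / c" if S: "S \<in> sets path_space" for S
  proof -
    have m: "(\<lambda>(\<omega>, s). indicator {0..} s * indicator {..<a} (X (max 0 s) \<omega>) * indicator S (kill_path s \<omega>) :: ennreal)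
        \<in> borel_measurable (P x \<Otimes>\<^sub>M lborel)"
      unfolding cong using S by (rule measurable_kill_integrand)
    have mS: "(\<lambda>z. indicator S (case z of (\<omega>, s) \<Rightarrow> kill_path s \<omega>) :: ennreal) \<in> borel_measurable (P x \<Otimes>\<^sub>M lborel)"
      using S by (intro measurable_compose[OF kill] borel_measurable_indicator)
    have "emeasure Q S = (\<integral>\<^sup>+z. indicator S z \<partial>Q)" using S by (simp add: Q_def)
    also have "\<dots> = (\<integral>\<^sup>+z. indicator S (case z of (\<omega>, s) \<Rightarrow> kill_path s \<omega>) \<partial>density (P x \<Otimes>\<^sub>M lborel) (\<lambda>z. w z / c))"
      unfolding Q_def using kill S by (intro nn_integral_distr) simp_all
    also have "\<dots> = (\<integral>\<^sup>+z. w z / c * indicator S (case z of (\<omega>, s) \<Rightarrow> kill_path s \<omega>) \<partial>(P x \<Otimes>\<^sub>M lborel))"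
      using w mS by (rule nn_integral_density)
    also have "\<dots> = (\<integral>\<^sup>+z. (case z of (\<omega>, s) \<Rightarrow> indicator {0..} s * indicator {..<a} (X (max 0 s) \<omega>) * indicator S (kill_path s \<omega>)) / c \<partial>(P x \<Otimes>\<^sub>M lborel))"
      by (intro nn_integral_cong) (simp add: w_def case_prod_beta divide_ennreal_def mult_ac)
    also have "\<dots> = (\<integral>\<^sup>+z. (case z of (\<omega>, s) \<Rightarrow> indicator {0..} s * indicator {..<a} (X (max 0 s) \<omega>) * indicator S (kill_path s \<omega>)) \<partial>(P x \<Otimes>\<^sub>M lborel)) / c"
      using m by (rule nn_integral_divide)
    also have "(\<integral>\<^sup>+z. (case z of (\<omega>, s) \<Rightarrow> indicator {0..} s * indicator {..<a} (X (max 0 s) \<omega>) * indicator S (kill_path s \<omega>)) \<partial>(P x \<Otimes>\<^sub>M lborel))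
       = killed_mass P a x S"
      using lborel.nn_integral_fst[OF m] by (simp add: killed_mass_def)
    finally show ?thesis .
  qed
  have alive: "emeasure Q {\<omega> \<in> A. ereal t < lifetime \<omega>} = emeasure M {\<omega> \<in> A. ereal t < lifetime \<omega>}"
    if "0 \<le> t" "A \<in> sets (filt t)" for t A
  proof -
    have "{\<omega> \<in> A. ereal t < lifetime \<omega>} \<in> sets path_space"
      using sets_filt_lifetime[OF that] sets_filt_path_space by auto
    then show ?thesis
      using killed_mass_alive[OF sub u that, of UNIV a x] down_law_alive[OF sub u down that]
      by (simp add: Q c_def sets_cemetery_borel)
  qed
  have M: "prob_space M" "sets M = sets path_space" using down unfolding down_law_def by blast+
  have "Q = M"
  proof (rule path_law_eqI)
    have "killed_mass P a x paths = (\<integral>\<^sup>+\<omega>. indicator paths \<omega> * (\<integral>\<^sup>+s\<in>{0..}. indicator {..<a} (X s \<omega>) \<partial>lborel) \<partial>P x)"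
      unfolding killed_mass_def
      by (intro nn_integral_cong)
        (auto simp: subordinator_space[OF sub] kill_path_in_paths indicator_def intro!: nn_integral_cong)
    also have "\<dots> = (\<integral>\<^sup>+y. indicator {..<a} y * occupation_density P u x 0 paths y \<partial>lborel)"
      by (intro nn_integral_occupation_density[OF sub u, symmetric]) simp_all
    also have "\<dots> = c" unfolding c_def by (rule nn_integral_occupation_density_0[OF sub u \<open>x < a\<close>])
    finally have "emeasure Q paths = 1" using c by (simp add: Q c_def less_top)
    then show "prob_space Q" by (intro prob_spaceI) (simp add: Q_def)
    show "sets Q = sets path_space" by (simp add: Q_def)
    show "emeasure Q E = emeasure M E" if "E \<in> alive_events" for E
      using that alive unfolding alive_events_def by blast
  qed (fact M)+
  then show ?thesis using Q[OF S] by (simp add: c_def)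
qed

lemma down_law_alive_left_limit:
  assumes sub: "subordinator \<kappa> \<nu> P" and u: "continuous_potential_density P u" and "x < a"
    and down: "down_law P a x M" and c: "renewal P (a - x) \<noteq> 0" "renewal P (a - x) \<noteq> \<infinity>"
    and t: "0 \<le> t" and A: "A \<in> sets (filt t)" and B: "B \<in> sets cemetery_borel"
  shows "emeasure M ({\<omega> \<in> A. ereal t < lifetime \<omega>} \<inter> X_lifetime_left -` B)
    = (\<integral>\<^sup>+y. indicator ({..<a} \<inter> Some -` B) y * occupation_density P u x t A y \<partial>lborel) / renewal P (a - x)"
  using down_law_eq_killed[OF sub u \<open>x < a\<close> down c sets_alive_left_limit[OF t A B]]
    killed_mass_alive[OF sub u t A B] by simp

lemma X_lifetime_left_Some_alive: "X_lifetime_left \<omega> = Some r \<Longrightarrow> 0 < lifetime \<omega>"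
  using X_lifetime_left_None[of \<omega>] by force

section \<open>Conditioning on the left limit at the lifetime\<close>

text \<open>Taking \<open>t = 0\<close> and the sure event in \<open>down_law_alive_left_limit\<close> gives the law of the left limit on
\<open>(x, a)\<close>: its density is \<open>u(y - x) / U(a - x)\<close>.\<close>

lemma nn_integral_left_limit_law:
  assumes sub: "subordinator \<kappa> \<nu> P" and u: "continuous_potential_density P u" and "x < a"
    and down: "down_law P a x M" and c: "renewal P (a - x) \<noteq> 0" "renewal P (a - x) \<noteq> \<infinity>"
    and f: "f \<in> borel_measurable cemetery_borel" and S: "S = Some ` {x<..<a}"
  shows "(\<integral>\<^sup>+z. f z * indicator S z \<partial>distr M cemetery_borel X_lifetime_left)
    = (\<integral>\<^sup>+y. indicator {x<..<a} y * (f (Some y) * potential_density u (y - x)) \<partial>lborel) / renewal P (a - x)"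
proof -
  have M: "prob_space M" "sets M = sets path_space" using down unfolding down_law_def by blast+
  have sp: "space M = paths" using sets_eq_imp_space_eq[OF M(2)] by simp
  have Z: "X_lifetime_left \<in> M \<rightarrow>\<^sub>M cemetery_borel"
    using measurable_X_lifetime_left measurable_cong_sets[OF M(2) refl] by blast
  define d where "d y = indicator {x<..<a} y * potential_density u (y - x) / renewal P (a - x)" for y
  have v: "(\<lambda>y. potential_density u (y - x)) \<in> borel_measurable borel"
    by (rule measurable_compose[OF _ measurable_potential_density[OF u]]) simp
  have d: "d \<in> borel_measurable lborel" unfolding d_def[abs_def] using v by simp
  have vim: "Some -` (B \<inter> S) = {x<..<a} \<inter> Some -` B" for B by (auto simp: S)
  have S': "S \<in> sets cemetery_borel" using vim[of UNIV] by (simp add: sets_cemetery_borel)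
  have "density (distr M cemetery_borel X_lifetime_left) (indicator S) = distr (density lborel d) cemetery_borel Some"
  proof (rule measure_eqI)
    fix B assume "B \<in> sets (density (distr M cemetery_borel X_lifetime_left) (indicator S))"
    then have B: "B \<in> sets cemetery_borel" by simp
    then have BS: "B \<inter> S \<in> sets cemetery_borel" using S' by auto
    have Bb: "Some -` B \<in> sets borel" using B by (simp add: sets_cemetery_borel)
    have "emeasure (density (distr M cemetery_borel X_lifetime_left) (indicator S)) B
        = (\<integral>\<^sup>+z. indicator S z * indicator B z \<partial>distr M cemetery_borel X_lifetime_left)"
      using B S' by (intro emeasure_density) simp_all
    also have "\<dots> = (\<integral>\<^sup>+z. indicator (B \<inter> S) z \<partial>distr M cemetery_borel X_lifetime_left)"
      by (intro nn_integral_cong) (auto simp: indicator_def)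
    also have "\<dots> = emeasure M (X_lifetime_left -` (B \<inter> S) \<inter> space M)"
      using BS Z by (simp add: emeasure_distr)
    also have "X_lifetime_left -` (B \<inter> S) \<inter> space M
        = {\<omega> \<in> paths. ereal 0 < lifetime \<omega>} \<inter> X_lifetime_left -` (B \<inter> S)"
      using X_lifetime_left_Some_alive by (auto simp: sp S zero_ereal_def[symmetric])
    also have "emeasure M \<dots>
        = (\<integral>\<^sup>+y. indicator ({..<a} \<inter> Some -` (B \<inter> S)) y * potential_density u (y - x) \<partial>lborel) / renewal P (a - x)"
      using down_law_alive_left_limit[OF sub u \<open>x < a\<close> down c order_refl _ BS, of paths]
      by (simp add: occupation_density_0[OF sub])
    also have "\<dots> = (\<integral>\<^sup>+y. indicator ({..<a} \<inter> Some -` (B \<inter> S)) y * potential_density u (y - x) / renewal P (a - x) \<partial>lborel)"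
      unfolding vim using Bb v by (intro nn_integral_divide[symmetric] borel_measurable_times_ennreal) auto
    also have "\<dots> = (\<integral>\<^sup>+y. d y * indicator (Some -` B) y \<partial>lborel)"
      unfolding vim by (intro nn_integral_cong) (auto simp: d_def indicator_def)
    also have "\<dots> = emeasure (density lborel d) (Some -` B)"
      using d Bb by (intro emeasure_density[symmetric]) simp_all
    also have "\<dots> = emeasure (distr (density lborel d) cemetery_borel Some) B"
      using B measurable_Some_cemetery_borel by (subst emeasure_distr) simp_all
    finally show "emeasure (density (distr M cemetery_borel X_lifetime_left) (indicator S)) B
       = emeasure (distr (density lborel d) cemetery_borel Some) B" .
  qed simp
  note eq = this
  have fS: "(\<lambda>y. f (Some y)) \<in> borel_measurable borel"
    using measurable_compose[OF measurable_Some_cemetery_borel f] .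
  have "(\<integral>\<^sup>+z. f z * indicator S z \<partial>distr M cemetery_borel X_lifetime_left)
      = (\<integral>\<^sup>+z. f z \<partial>density (distr M cemetery_borel X_lifetime_left) (indicator S))"
    using f S' by (subst nn_integral_density) (simp_all add: mult.commute)
  also have "\<dots> = (\<integral>\<^sup>+y. f (Some y) \<partial>density lborel d)"
    unfolding eq using f measurable_Some_cemetery_borel by (subst nn_integral_distr) simp_all
  also have "\<dots> = (\<integral>\<^sup>+y. d y * f (Some y) \<partial>lborel)"
    using d fS by (intro nn_integral_density) simp_all
  also have "\<dots> = (\<integral>\<^sup>+y. indicator {x<..<a} y * (f (Some y) * potential_density u (y - x)) / renewal P (a - x) \<partial>lborel)"
    by (intro nn_integral_cong) (simp add: d_def divide_ennreal_def mult_ac)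
  also have "\<dots> = (\<integral>\<^sup>+y. indicator {x<..<a} y * (f (Some y) * potential_density u (y - x)) \<partial>lborel) / renewal P (a - x)"
    using fS v by (intro nn_integral_divide borel_measurable_times_ennreal) auto
  finally show ?thesis .
qed

theorem theorem2p6:
  fixes P :: "real \<Rightarrow> path measure" and \<nu> :: "real measure" and u :: "real \<Rightarrow> real"
    and \<kappa> a x :: real and Pdown :: "path measure" and Pcirc :: "real \<Rightarrow> path measure"
  assumes "subordinator \<kappa> \<nu> P"
    and "continuous_potential_density P u"
    and "0 < a" and "0 \<le> x" and "x < a"
    and "down_law P a x Pdown"
    and "\<And>y. x < y \<Longrightarrow> y < a \<Longrightarrow> circ_law P u y x (Pcirc y)"
  shows "conditional_law_on Pdown X_lifetime_left cemetery_borel (Some ` {x<..<a})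
           (\<lambda>z. Pcirc (the z))"
proof -
  note sub = assms(1) and u = assms(2) and down = assms(6) and circ = assms(7)
  define S where "S = Some ` {x<..<a}"
  let ?v = "\<lambda>y. potential_density u (y - x)" and ?k = "\<lambda>t A y. occupation_density P u x t A y"
  let ?N = "distr Pdown cemetery_borel X_lifetime_left"
  have M: "prob_space Pdown" "sets Pdown = sets path_space" using down unfolding down_law_def by blast+
  have sp: "space Pdown = paths" using sets_eq_imp_space_eq[OF M(2)] by simp
  have Z: "X_lifetime_left \<in> Pdown \<rightarrow>\<^sub>M cemetery_borel"
    using measurable_X_lifetime_left measurable_cong_sets[OF M(2) refl] by blast
  have "Some -` S = {x<..<a}" by (auto simp: S_def)
  then have S: "S \<in> sets cemetery_borel" by (simp add: sets_cemetery_borel)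
  have v: "?v \<in> borel_measurable borel"
    by (rule measurable_compose[OF _ measurable_potential_density[OF u]]) simp
  define h where "h t A z = (if ?v (the z) = 0 then 0 else ?k t A (the z) / ?v (the z))" for t A and z :: "real option"
  have h: "h t A \<in> borel_measurable cemetery_borel" if "0 \<le> t" "A \<in> sets (filt t)" for t A
  proof -
    have A: "A \<in> sets path_space" using that sets_filt_path_space by auto
    note k = measurable_occupation_density[OF sub u that(1) A, of x]
    have "(\<lambda>y. if ?v y = 0 then 0 else ?k t A y / ?v y) \<in> borel_measurable borel"
      using v k by measurable
    from measurable_compose[OF measurable_the_cemetery_borel this] show ?thesis
      by (simp add: h_def[abs_def])
  qed
  have K_eq: "emeasure (Pcirc (the z)) {\<omega> \<in> A. ereal t < lifetime \<omega>} = h t A z"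
    if "z \<in> S" "0 \<le> t" "A \<in> sets (filt t)" for z t A
    using that circ circ_law_occupation_density[OF sub u _ _ that(2,3)] by (auto simp: S_def h_def)
  have K: "(\<lambda>z. Pcirc (the z)) \<in> restrict_space cemetery_borel S \<rightarrow>\<^sub>M prob_algebra Pdown"
  proof (rule measurable_prob_algebra_generated)
    show "sets Pdown = sigma_sets paths alive_events" using M(2) sets_path_space_alive by simp
    show "Int_stable alive_events" "alive_events \<subseteq> Pow paths"
      by (fact Int_stable_alive_events alive_events_Pow)+
    fix z assume "z \<in> space (restrict_space cemetery_borel S)"
    then have "z \<in> S" by (simp add: space_restrict_space)
    then have "circ_law P u (the z) x (Pcirc (the z))" using circ by (auto simp: S_def)
    then show "prob_space (Pcirc (the z))" "sets (Pcirc (the z)) = sets Pdown"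
      unfolding circ_law_def M(2) by blast+
  next
    fix E assume "E \<in> alive_events"
    then obtain t A where t: "0 \<le> t" "A \<in> sets (filt t)" and E: "E = {\<omega> \<in> A. ereal t < lifetime \<omega>}"
      unfolding alive_events_def by blast
    have "h t A \<in> borel_measurable (restrict_space cemetery_borel S)"
      using h[OF t] by (rule measurable_restrict_space1)
    then show "(\<lambda>z. emeasure (Pcirc (the z)) E) \<in> borel_measurable (restrict_space cemetery_borel S)"
      by (rule measurable_cong[THEN iffD1, rotated]) (simp add: E K_eq[OF _ t] space_restrict_space)
  qed
  show ?thesis
    unfolding S_def[symmetric]
  proof (rule conditional_law_on_generatorI[OF M(1) Z S K])
    show "sets Pdown = sigma_sets (space Pdown) alive_events" "Int_stable alive_events"
      "alive_events \<subseteq> Pow (space Pdown)"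
      unfolding sp M(2) by (fact sets_path_space_alive Int_stable_alive_events alive_events_Pow)+
    fix E B assume "E \<in> alive_events" and B: "B \<in> sets cemetery_borel" "B \<subseteq> S"
    then obtain t A where t: "0 \<le> t" "A \<in> sets (filt t)" and E: "E = {\<omega> \<in> A. ereal t < lifetime \<omega>}"
      unfolding alive_events_def by blast
    have B': "Some -` B \<subseteq> {x<..<a}" using B by (auto simp: S_def)
    have alive: "X_lifetime_left -` B \<inter> paths \<subseteq> {\<omega> \<in> paths. 0 < lifetime \<omega>}"
      using B X_lifetime_left_Some_alive by (auto simp: S_def)
    show "emeasure Pdown (E \<inter> X_lifetime_left -` B) = (\<integral>\<^sup>+z\<in>B. emeasure (Pcirc (the z)) E \<partial>?N)"
    proof (cases "renewal P (a - x) = 0 \<or> renewal P (a - x) = \<infinity>")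
      \<comment> \<open>The path is \<open>\<Delta>\<close> from the start almost surely, so the left limit is almost never in \<open>B\<close>.\<close>
      case True
      have "{\<omega> \<in> space path_space. 0 < lifetime \<omega>} \<in> sets path_space" by measurable
      then have null: "{\<omega> \<in> paths. 0 < lifetime \<omega>} \<in> null_sets Pdown"
        using down_law_degenerate[OF sub u \<open>x < a\<close> down True] M(2) by (simp add: null_sets_def)
      have "A \<subseteq> paths" using sets.sets_into_space[OF t(2)] by simp
      then have "E \<inter> X_lifetime_left -` B \<subseteq> {\<omega> \<in> paths. 0 < lifetime \<omega>}" using alive by (auto simp: E)
      then have "emeasure Pdown (E \<inter> X_lifetime_left -` B) = 0"
        using emeasure_mono[of "E \<inter> X_lifetime_left -` B" "{\<omega> \<in> paths. 0 < lifetime \<omega>}" Pdown] null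
        by (simp add: null_sets_def)
      moreover have "emeasure Pdown (X_lifetime_left -` B \<inter> space Pdown) = 0"
        using emeasure_mono[OF alive, of Pdown] null by (auto simp: sp null_sets_def)
      then have "B \<in> null_sets ?N" using B Z by (simp add: null_sets_def emeasure_distr)
      ultimately show ?thesis by (simp add: nn_integral_null_set)
    next
      case False
      have Bb: "Some -` B \<in> sets borel" using B by (simp add: sets_cemetery_borel)
      have "(\<integral>\<^sup>+z\<in>B. emeasure (Pcirc (the z)) E \<partial>?N) = (\<integral>\<^sup>+z. (h t A z * indicator B z) * indicator S z \<partial>?N)"
        using B by (intro nn_integral_cong) (auto simp: E K_eq[OF _ t] indicator_def)
      also have "\<dots> = (\<integral>\<^sup>+y. indicator {x<..<a} y * (h t A (Some y) * indicator B (Some y) * ?v y) \<partial>lborel) / renewal P (a - x)"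
        using False h[OF t] B
        by (intro nn_integral_left_limit_law[OF sub u \<open>x < a\<close> down _ _ _ S_def] borel_measurable_times_ennreal) auto
      also have "(\<integral>\<^sup>+y. indicator {x<..<a} y * (h t A (Some y) * indicator B (Some y) * ?v y) \<partial>lborel)
         = (\<integral>\<^sup>+y. indicator ({..<a} \<inter> Some -` B) y * ?k t A y \<partial>lborel)"
      proof (rule nn_integral_cong_AE)
        show "AE y in lborel. indicator {x<..<a} y * (h t A (Some y) * indicator B (Some y) * ?v y)
            = indicator ({..<a} \<inter> Some -` B) y * ?k t A y"
          using occupation_density_null[OF sub u t, of x]
        proof eventually_elim
          case (elim y)
          \<comment> \<open>Where the density vanishes, both sides are zero; elsewhere the quotient in \<open>h\<close> cancels.\<close>
          have "?v y < top" by (simp add: potential_density_def indicator_def)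
          then have "h t A (Some y) * ?v y = ?k t A y"
            using elim by (auto simp: h_def ennreal_divide_times)
          moreover have "y \<in> {x<..<a}" if "Some y \<in> B" using that B' by auto
          ultimately show ?case by (auto simp: indicator_def)
        qed
      qed
      also have "\<dots> / renewal P (a - x) = emeasure Pdown (E \<inter> X_lifetime_left -` B)"
        using down_law_alive_left_limit[OF sub u \<open>x < a\<close> down _ _ t B(1)] False by (simp add: E)
      finally show ?thesis by simp
    qed
  qed
qed

end
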